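(* Let $\beta>1$, let $0\le t\le 1-\frac1\beta$, write $\overline{d}_\beta(t)=as$ with $a\in A_\beta$, $s\in A_\beta^{\mathbb{N}}$, put $b=a+1$ and $I=[t,t+\frac1\beta]$. Assume that $s>a^\omega$, that $s<b^\omega$, and that there is no $\alpha\in[a,b]$ with $as=s_{\alpha,0}$ or $bs=s'_{\alpha,0}$. Let $u$ be the longest prefix of $s$ that is a central word over $\{a,b\}$. Then $I$ contains a unique invariant $\overline{T}_\beta$-orbit closure, described as follows. (a) Suppose $u=a^k$ for some $k\ge1$, and write $s=a^kvs'$ with $v\in A_\beta^{k+1}$, $s'\in A_\beta^{\mathbb{N}}$. (i) If $v<a^{k+1}$, then $s\le a^\omega$. (ii) If $a^{k+1}<v<ba^k$, then $I$ contains the orbit closure of $((ba^{k+1})^\omega)_\beta$, whose frequency is $a+\frac1{k+2}$. (iii) If $v>ba^k$, then $I$ contains the orbit closure of $((ba^k)^\omega)_\beta$, whose frequency is $a+\frac1{k+1}$. (b) Suppose $u=b^k$ for some $k\ge1$, and write $s=b^kvs'$ with $v\in A_\beta^{k+1}$, $s'\in A_\beta^{\mathbb{N}}$. (i) If $v>b^{k+1}$, then $s\ge b^\omega$. (ii) If $ab^k<v<b^{k+1}$, then $I$ contains the orbit closure of $((b^{k+1}a)^\omega)_\beta$, whose frequency is $b-\frac1{k+2}$. (iii) If $v<ab^k$, then $I$ contains the orbit closure of $((b^ka)^\omega)_\beta$, whose frequency is $b-\frac1{k+1}$. (c) Suppose $u$ is not a power of a single letter, let $p,q$ be the unique central words with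 $u=pabq=qbap$, and write $s=uxyvs'$ with $x,y\in A_\beta$, $v\in A_\beta^{|u|+2}$, $s'\in A_\beta^{\mathbb{N}}$. (i) If either $xy=ab$ and $v>uab$, or $xy=ba$ and $v<uba$, then $I$ contains the orbit closure of $((bua)^\omega)_\beta$, whose frequency is $a+\frac{|u|_b+1}{|u|+2}$. (ii) If either $xy=ab$ and $v<uab$, or $xy\le aa$, then $I$ contains the orbit closure of $((bqa)^\omega)_\beta$, whose frequency is $a+\frac{|q|_b+1}{|q|+2}$. (iii) If either $xy=ba$ and $v>uba$, or $xy\ge bb$, then $I$ contains the orbit closure of $((bpa)^\omega)_\beta$, whose frequency is $a+\frac{|p|_b+1}{|p|+2}$. (In every inequality involving $v$, equality cannot occur.)
   Context: For $\beta>1$ let $A_\beta=\{0,1,\dots,\lceil\beta\rceil-1\}$. Words over nonnegative integers are compared lexicographically, a finite word $w$ being identified with $w0^\omega$. For a word $w=w_1w_2\cdots$, $(w)_\beta=\sum_{i\ge1}w_i\beta^{-i}$; $v^\omega=vvv\cdots$; $|w|$ is the length and $|w|_b$ the number of occurrences of the letter $b$ in $w$. Define $\langle t\rangle=\{t\}$ (fractional part) if $t\notin\mathbb{Z}$ and $\langle t\rangle=1$ if $t\in\mathbb{Z}$. The $\overline{\beta}$-transformation is $\overline{T}_\beta(x)=\langle\beta x\rangle$ on $[0,1]$ and the $\overline{\beta}$-expansion of $x\in[0,1]$ is $\overline{d}_\beta(x)=(x_i)_{i\ge1}$, $x_i=\lceil\beta\overline{T}_\beta^{i-1}(x)\rceil-1$.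 A $\overline{T}_\beta$-orbit closure is the closure of $\{\overline{T}_\beta^n(x):n\ge0\}$; it is invariant if $\overline{T}_\beta(S)=S$. The frequency of $x$ is $\lim_{n\to\infty}\frac1n\sum_{k=1}^na_k$ where $\overline{d}_\beta(x)=a_1a_2\cdots$; a set has frequency $\alpha$ if all its elements do. For real $\alpha\ge0$, $s_{\alpha,0}$ and $s'_{\alpha,0}$ are the infinite words with $n$-th letters ($n\ge0$) $\lfloor\alpha(n+1)\rfloor-\lfloor\alpha n\rfloor$ and $\lceil\alpha(n+1)\rceil-\lceil\alpha n\rceil$. A palindrome is a finite word equal to its reversal. A word over the two-letter alphabet $\{a,b\}$ ($a<b$) is central if it is a power of a single letter (including the empty word) or it is a palindrome of the form $xaby$ with $x,y$ palindromes (equivalently, central words are the words $z$ such that $azb$ is the lower Christoffel word, i.e. the shortest period, of $s_{\alpha,0}$ for some rational $\alpha\in(a,b)$). If $u$ is central and not a power of a single letter, there are unique palindromes $p,q$ with $u=pabq=qbap$, and $p,q$ are central. *)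

theory Defs
  imports "HOL-Analysis.Analysis" "HOL-Library.Stream"
begin

text \<open>
  Letters are integers, finite words are lists, and right-infinite words are streams, indexed
  from \<open>0\<close>. Hence \<open>v\<^sup>\<omega>\<close> is \<open>cycle v\<close> for nonempty \<open>v\<close>, \<open>c\<^sup>\<omega>\<close> is \<open>sconst c\<close> for a letter \<open>c\<close>,
  and \<open>c\<^sup>k\<close> is \<open>replicate k c\<close>.
\<close>

definition digits :: "real \<Rightarrow> int set" where
  "digits \<beta> = {0..\<lceil>\<beta>\<rceil> - 1}"

definition word_less :: "int stream \<Rightarrow> int stream \<Rightarrow> bool"  (infix "<\<^sub>l\<^sub>e\<^sub>x" 50) where
  "x <\<^sub>l\<^sub>e\<^sub>x y \<longleftrightarrow> (\<exists>n. (\<forall>i<n. x !! i = y !! i) \<and> x !! n < y !! n)"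

definition word_le :: "int stream \<Rightarrow> int stream \<Rightarrow> bool"  (infix "\<le>\<^sub>l\<^sub>e\<^sub>x" 50) where
  "x \<le>\<^sub>l\<^sub>e\<^sub>x y \<longleftrightarrow> x <\<^sub>l\<^sub>e\<^sub>x y \<or> x = y"

text \<open>The identification of a finite word \<open>w\<close> with \<open>w0\<^sup>\<omega>\<close>, used when comparing finite words.\<close>

definition pad :: "int list \<Rightarrow> int stream" where
  "pad w = w @- sconst 0"

definition word_value :: "real \<Rightarrow> int stream \<Rightarrow> real" where
  "word_value \<beta> w = (\<Sum>n. of_int (w !! n) / \<beta> ^ (n + 1))"

definition angle_frac :: "real \<Rightarrow> real" where
  "angle_frac x = (if x \<in> \<int> then 1 else frac x)"

definition bar_T :: "real \<Rightarrow> real \<Rightarrow> real" where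
  "bar_T \<beta> x = angle_frac (\<beta> * x)"

text \<open>At the point \<open>0\<close> the formula gives \<open>-1\<close> as the first digit, which is not in \<open>digits \<beta>\<close>.\<close>

definition bar_expansion :: "real \<Rightarrow> real \<Rightarrow> int stream" where
  "bar_expansion \<beta> x = smap (\<lambda>n. \<lceil>\<beta> * (bar_T \<beta> ^^ n) x\<rceil> - 1) nats"

definition orbit_closure :: "real \<Rightarrow> real \<Rightarrow> real set" where
  "orbit_closure \<beta> x = closure (range (\<lambda>n. (bar_T \<beta> ^^ n) x))"

definition is_orbit_closure :: "real \<Rightarrow> real set \<Rightarrow> bool" where
  "is_orbit_closure \<beta> S \<longleftrightarrow> (\<exists>x\<in>{0..1}. S = orbit_closure \<beta> x)"

definition invariant :: "real \<Rightarrow> real set \<Rightarrow> bool" where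
  "invariant \<beta> S \<longleftrightarrow> bar_T \<beta> ` S = S"

definition has_frequency :: "real \<Rightarrow> real \<Rightarrow> real \<Rightarrow> bool" where
  "has_frequency \<beta> x \<alpha> \<longleftrightarrow>
     (\<lambda>n. (\<Sum>k<n. of_int (bar_expansion \<beta> x !! k)) / real n) \<longlonglongrightarrow> \<alpha>"

definition set_has_frequency :: "real \<Rightarrow> real set \<Rightarrow> real \<Rightarrow> bool" where
  "set_has_frequency \<beta> S \<alpha> \<longleftrightarrow> (\<forall>x\<in>S. has_frequency \<beta> x \<alpha>)"

definition contains_orbit_closure_of :: "real \<Rightarrow> real set \<Rightarrow> int list \<Rightarrow> real \<Rightarrow> bool" where
  "contains_orbit_closure_of \<beta> I w \<alpha> \<longleftrightarrow>
     (let S = orbit_closure \<beta> (word_value \<beta> (cycle w))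
      in is_orbit_closure \<beta> S \<and> invariant \<beta> S \<and> S \<subseteq> I \<and> set_has_frequency \<beta> S \<alpha>)"

text \<open>The words \<open>s\<^sub>\<alpha>\<^sub>,\<^sub>0\<close> and \<open>s'\<^sub>\<alpha>\<^sub>,\<^sub>0\<close>.\<close>

definition lower_mech :: "real \<Rightarrow> int stream" where
  "lower_mech \<alpha> = smap (\<lambda>n. \<lfloor>\<alpha> * (real n + 1)\<rfloor> - \<lfloor>\<alpha> * real n\<rfloor>) nats"

definition upper_mech :: "real \<Rightarrow> int stream" where
  "upper_mech \<alpha> = smap (\<lambda>n. \<lceil>\<alpha> * (real n + 1)\<rceil> - \<lceil>\<alpha> * real n\<rceil>) nats"

definition palindrome :: "int list \<Rightarrow> bool" where
  "palindrome w \<longleftrightarrow> rev w = w"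

definition letter_power :: "int list \<Rightarrow> bool" where
  "letter_power w \<longleftrightarrow> (\<exists>c k. w = replicate k c)"

definition central :: "int \<Rightarrow> int \<Rightarrow> int list \<Rightarrow> bool" where
  "central a b w \<longleftrightarrow> set w \<subseteq> {a, b} \<and>
     (letter_power w \<or>
      palindrome w \<and> (\<exists>x y. palindrome x \<and> palindrome y \<and> w = x @ [a, b] @ y))"

definition longest_central_prefix :: "int \<Rightarrow> int \<Rightarrow> int stream \<Rightarrow> int list \<Rightarrow> bool" where
  "longest_central_prefix a b s u \<longleftrightarrow>
     central a b u \<and> stake (length u) s = u \<and>
     (\<forall>w. central a b w \<and> stake (length w) s = w \<longrightarrow> length w \<le> length u)"

definition central_decomp :: "int \<Rightarrow> int \<Rightarrow> int list \<Rightarrow> int list \<Rightarrow> int list \<Rightarrow> bool" where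
  "central_decomp a b u p q \<longleftrightarrow>
     central a b p \<and> central a b q \<and> u = p @ [a, b] @ q \<and> u = q @ [b, a] @ p"

end

theory Submission
  imports Defs
begin

text \<open>
  The expansions of \<open>t\<close> and \<open>t + 1/\<beta>\<close> are \<open>as\<close> and \<open>bs\<close>, so the points whose orbit stays in \<open>I\<close>
  correspond to the words all of whose shifts lie in \<open>[as, bs]\<close>. If \<open>z\<close> is central and \<open>s\<close> lies in
  the gap \<open>(zab)\<^sup>\<omega> < s < (zba)\<^sup>\<omega>\<close>, a descent on the first difference shows that these shifts lie
  in fact in \<open>[(azb)\<^sup>\<omega>, (bza)\<^sup>\<omega>]\<close>. The two bounds are the lower and upper mechanical words of slope
  \<open>H/N\<close>, where \<open>N = |z| + 2\<close> and \<open>H\<close> is the digit sum of \<open>azb\<close>; hence any \<open>N\<close> consecutive letters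
  have sum \<open>H\<close>, the word is periodic, and it is a shift of \<open>(bza)\<^sup>\<omega>\<close>. So in a gap the invariant
  orbit closure is unique.

  It remains to see that \<open>s\<close> lies in a gap. If \<open>s\<close> had arbitrarily long central prefixes, \<open>as\<close> or
  \<open>bs\<close> would be mechanical. Otherwise the longest central prefix \<open>u = pabq = qbap\<close> and the letters
  following it determine the gap: \<open>z\<close> is \<open>u\<close>, \<open>q\<close> or \<open>p\<close>, because
  \<open>(qba)\<^sup>\<omega> = uab(qab)\<^sup>\<omega>\<close> and \<open>uabq\<close> is central.
\<close>

section \<open>The lexicographic order\<close>

lemma stream_eqI: "(\<And>n. x !! n = y !! n) \<Longrightarrow> x = y"
  by (metis smap_alt stream.map_id0 id_apply)

lemma word_less_Cons [simp]: "c ## x <\<^sub>l\<^sub>e\<^sub>x d ## y \<longleftrightarrow> c < d \<or> c = d \<and> x <\<^sub>l\<^sub>e\<^sub>x y"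
proof
  assume "c ## x <\<^sub>l\<^sub>e\<^sub>x d ## y"
  then obtain n where n: "\<forall>i<n. (c ## x) !! i = (d ## y) !! i" "(c ## x) !! n < (d ## y) !! n"
    by (auto simp: word_less_def)
  show "c < d \<or> c = d \<and> x <\<^sub>l\<^sub>e\<^sub>x y"
  proof (cases n)
    case 0
    then show ?thesis using n by simp
  next
    case (Suc m)
    then have "x !! i = y !! i" if "i < m" for i
      using n(1)[rule_format, of "Suc i"] that by simp
    then show ?thesis
      using n Suc unfolding word_less_def by auto
  qed
next
  assume "c < d \<or> c = d \<and> x <\<^sub>l\<^sub>e\<^sub>x y"
  then show "c ## x <\<^sub>l\<^sub>e\<^sub>x d ## y"
  proof
    assume "c < d"
    then show ?thesis unfolding word_less_def by (intro exI[of _ 0]) simp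
  next
    assume *: "c = d \<and> x <\<^sub>l\<^sub>e\<^sub>x y"
    then obtain n where "\<forall>i<n. x !! i = y !! i" "x !! n < y !! n"
      by (auto simp: word_less_def)
    then show ?thesis using * unfolding word_less_def
      by (intro exI[of _ "Suc n"]) (auto simp: less_Suc_eq_0_disj)
  qed
qed

lemma word_less_shift [simp]: "w @- x <\<^sub>l\<^sub>e\<^sub>x w @- y \<longleftrightarrow> x <\<^sub>l\<^sub>e\<^sub>x y"
  by (induction w) auto

lemma word_less_irrefl [simp]: "\<not> x <\<^sub>l\<^sub>e\<^sub>x x"
  by (auto simp: word_less_def)

lemma word_less_trans:
  assumes "x <\<^sub>l\<^sub>e\<^sub>x y" "y <\<^sub>l\<^sub>e\<^sub>x z"
  shows "x <\<^sub>l\<^sub>e\<^sub>x z"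
proof -
  obtain n where n: "\<forall>i<n. x !! i = y !! i" "x !! n < y !! n"
    using assms by (auto simp: word_less_def)
  obtain m where m: "\<forall>i<m. y !! i = z !! i" "y !! m < z !! m"
    using assms by (auto simp: word_less_def)
  show ?thesis unfolding word_less_def
  proof (intro exI conjI allI impI)
    show "x !! i = z !! i" if "i < min n m" for i
      using that n m by simp
    show "x !! min n m < z !! min n m"
      using n m by (cases n m rule: linorder_cases) (auto simp: min_def)
  qed
qed

lemma word_less_linear: "x <\<^sub>l\<^sub>e\<^sub>x y \<or> x = y \<or> y <\<^sub>l\<^sub>e\<^sub>x x"
proof (cases "x = y")
  case False
  then have ex: "\<exists>n. x !! n \<noteq> y !! n"
    using stream_eqI by blast
  define n where "n = (LEAST n. x !! n \<noteq> y !! n)"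
  have "x !! n \<noteq> y !! n" "\<forall>i<n. x !! i = y !! i"
    using LeastI_ex[OF ex] not_less_Least unfolding n_def by auto
  then show ?thesis unfolding word_less_def by (metis linorder_neqE)
qed simp

lemma word_less_asym: "x <\<^sub>l\<^sub>e\<^sub>x y \<Longrightarrow> \<not> y <\<^sub>l\<^sub>e\<^sub>x x"
  using word_less_trans word_less_irrefl by blast

lemma word_not_le: "\<not> x \<le>\<^sub>l\<^sub>e\<^sub>x y \<longleftrightarrow> y <\<^sub>l\<^sub>e\<^sub>x x"
  using word_less_linear word_less_asym word_le_def by blast

lemma word_le_less_trans: "x \<le>\<^sub>l\<^sub>e\<^sub>x y \<Longrightarrow> y <\<^sub>l\<^sub>e\<^sub>x z \<Longrightarrow> x <\<^sub>l\<^sub>e\<^sub>x z"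
  and word_less_le_trans: "x <\<^sub>l\<^sub>e\<^sub>x y \<Longrightarrow> y \<le>\<^sub>l\<^sub>e\<^sub>x z \<Longrightarrow> x <\<^sub>l\<^sub>e\<^sub>x z"
  by (auto simp: word_le_def intro: word_less_trans)

lemma word_le_Cons [simp]: "c ## x \<le>\<^sub>l\<^sub>e\<^sub>x d ## y \<longleftrightarrow> c < d \<or> c = d \<and> x \<le>\<^sub>l\<^sub>e\<^sub>x y"
  by (auto simp: word_le_def)

section \<open>Finite words compared after padding by zeros\<close>

lemma pad_less_Cons [simp]: "pad (c # v) <\<^sub>l\<^sub>e\<^sub>x pad (d # w) \<longleftrightarrow> c < d \<or> c = d \<and> pad v <\<^sub>l\<^sub>e\<^sub>x pad w"
  by (simp add: pad_def)

text \<open>Equal lengths place the first difference inside the two words, so the padding may be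
  replaced by arbitrary tails.\<close>

lemma pad_less_imp_shift_less:
  "length v = length w \<Longrightarrow> pad v <\<^sub>l\<^sub>e\<^sub>x pad w \<Longrightarrow> v @- x <\<^sub>l\<^sub>e\<^sub>x w @- y"
  by (induction v w rule: list_induct2) auto

lemma pad_less_linear:
  "length v = length w \<Longrightarrow> pad v <\<^sub>l\<^sub>e\<^sub>x pad w \<or> v = w \<or> pad w <\<^sub>l\<^sub>e\<^sub>x pad v"
  by (induction v w rule: list_induct2) auto

text \<open>Once the first \<open>length q\<close> letters of \<open>v\<close> differ from
  \<open>q\<close>, the comparison is decided among them. A bound on \<open>v\<close> can then be
  reused against any other word that starts with \<open>q\<close>.\<close>

lemma pad_less_take:
  assumes "pad v <\<^sub>l\<^sub>e\<^sub>x pad (q @ w)" "length v = length (q @ w)" "take (length q) v \<noteq> q"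
  shows "pad (take (length q) v) <\<^sub>l\<^sub>e\<^sub>x pad q"
  using assms
proof (induction q arbitrary: v)
  case (Cons c q)
  then show ?case by (cases v) auto
qed simp

lemma prefix_between:
  assumes "w @- x \<le>\<^sub>l\<^sub>e\<^sub>x z" "z \<le>\<^sub>l\<^sub>e\<^sub>x w @- y"
  shows "\<exists>z'. z = w @- z' \<and> x \<le>\<^sub>l\<^sub>e\<^sub>x z' \<and> z' \<le>\<^sub>l\<^sub>e\<^sub>x y"
  using assms
proof (induction w arbitrary: z)
  case (Cons c w)
  then show ?case by (cases z) auto
qed simp

text \<open>Negation sends the letters a < b to -b < -a, again consecutive integers, and reverses
  the order. It is used to obtain upper bounds from lower ones and to halve a case
  distinction.\<close>

lemma smap_uminus_less: "smap uminus x <\<^sub>l\<^sub>e\<^sub>x smap uminus y \<longleftrightarrow> y <\<^sub>l\<^sub>e\<^sub>x x"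
  unfolding word_less_def by (auto; metis)

lemma smap_uminus_eq: "smap uminus x = smap uminus y \<longleftrightarrow> x = (y :: int stream)"
proof
  assume "smap uminus x = smap uminus y"
  then have "smap uminus x !! n = smap uminus y !! n" for n by simp
  then show "x = y" by (intro stream_eqI) simp
qed simp

lemma smap_uminus_le: "smap uminus x \<le>\<^sub>l\<^sub>e\<^sub>x smap uminus y \<longleftrightarrow> y \<le>\<^sub>l\<^sub>e\<^sub>x x"
  by (auto simp: word_le_def smap_uminus_less smap_uminus_eq)

lemma smap_cycle: "w \<noteq> [] \<Longrightarrow> smap f (cycle w) = cycle (map f w)"
proof (coinduction arbitrary: w)
  case Eq_stream
  then show ?case
    by (intro conjI exI[of _ "tl w @ [hd w]"]) (auto simp: hd_map map_tl)
qed

section \<open>Partial sums and mechanical words\<close>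

definition psum :: "int stream \<Rightarrow> nat \<Rightarrow> int" where
  "psum w n = sum_list (stake n w)"

lemma psum_0 [simp]: "psum w 0 = 0"
  by (simp add: psum_def)

lemma psum_Suc: "psum w (Suc n) = psum w n + w !! n"
  by (simp add: psum_def stake_Suc del: stake.simps)

lemma psum_Cons_Suc [simp]: "psum (c ## w) (Suc n) = c + psum w n"
  by (simp add: psum_def)

lemma psum_add: "psum w (m + n) = psum w m + psum (sdrop m w) n"
  by (simp add: psum_def stake_add[symmetric] del: stake_add)

lemma psum_eq_sum: "psum w n = (\<Sum>k<n. w !! k)"
  by (induction n) (auto simp: psum_Suc)

lemma psum_inject:
  assumes "\<And>n. psum x n = psum y n"
  shows "x = y"
proof (rule stream_eqI)
  fix n
  show "x !! n = y !! n" using assms[of n] assms[of "Suc n"] by (simp add: psum_Suc)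
qed

text \<open>If \<open>x\<close> were larger, the partial sums just after the first difference would
  already be in the wrong order.\<close>

lemma psum_le_imp_word_le:
  assumes "\<And>n. psum x n \<le> psum y n"
  shows "x \<le>\<^sub>l\<^sub>e\<^sub>x y"
proof (rule ccontr)
  assume "\<not> x \<le>\<^sub>l\<^sub>e\<^sub>x y"
  then obtain n where n: "\<forall>i<n. y !! i = x !! i" "y !! n < x !! n"
    by (auto simp: word_not_le word_less_def)
  then have "psum y n = psum x n" by (simp add: psum_eq_sum)
  then show False using n assms[of "Suc n"] by (simp add: psum_Suc)
qed

lemma psum_lower_mech: "psum (lower_mech \<alpha>) n = \<lfloor>\<alpha> * n\<rfloor>"
  by (induction n) (auto simp: psum_Suc lower_mech_def algebra_simps)

lemma psum_upper_mech: "psum (upper_mech \<alpha>) n = \<lceil>\<alpha> * n\<rceil>"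
  by (induction n) (auto simp: psum_Suc upper_mech_def algebra_simps)

lemma lower_mech_eqI: "(\<And>n. psum w n = \<lfloor>\<alpha> * n\<rfloor>) \<Longrightarrow> w = lower_mech \<alpha>"
  by (rule psum_inject) (simp add: psum_lower_mech)

lemma upper_mech_eqI: "(\<And>n. psum w n = \<lceil>\<alpha> * n\<rceil>) \<Longrightarrow> w = upper_mech \<alpha>"
  by (rule psum_inject) (simp add: psum_upper_mech)

lemma sum_list_concat_replicate: "sum_list (concat (replicate k w)) = int k * sum_list w"
  by (induction k) (auto simp: algebra_simps)

lemma psum_cycle:
  assumes "w \<noteq> []"
  shows "psum (cycle w) n =
    int (n div length w) * sum_list w + sum_list (take (n mod length w) w)"
  using assms by (simp add: psum_def stake_cycle sum_list_concat_replicate)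

text \<open>
  The path of partial sums of \<open>w\<close> stays strictly below the segment joining its end points, at
  vertical distance less than \<open>1\<close>: \<open>w\<close> is a lower Christoffel word.
\<close>

definition christoffel :: "int list \<Rightarrow> bool" where
  "christoffel w \<longleftrightarrow> (\<forall>n. 0 < n \<and> n < length w \<longrightarrow>
     sum_list (take n w) * int (length w) < int n * sum_list w \<and>
     int n * sum_list w < (sum_list (take n w) + 1) * int (length w))"

text \<open>The determinant 1 makes the slopes of \<open>v\<close> and \<open>w\<close> neighbouring
  fractions h/Q < g/P, and the concatenation has their mediant as slope. The bounds for each factor
  carry over to the mediant because strict inequalities between integers leave room for 1, which
  absorbs the change of slope.\<close>

lemma christoffel_append:
  assumes v: "christoffel v" and w: "christoffel w" and "v \<noteq> []" "w \<noteq> []"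
    and det: "sum_list w * int (length v) - sum_list v * int (length w) = 1"
  shows "christoffel (v @ w)"
  unfolding christoffel_def
proof (intro allI impI)
  fix n assume n: "0 < n \<and> n < length (v @ w)"
  define Q P h g where "Q = int (length v)" and "P = int (length w)"
    and "h = sum_list v" and "g = sum_list w"
  have pos: "Q > 0" "P > 0" using assms by (auto simp: Q_def P_def)
  have det: "g * Q = h * P + 1" using det by (simp add: Q_def P_def h_def g_def)
  have eqs: "int (length (v @ w)) = Q + P" "sum_list (v @ w) = h + g"
    by (auto simp: Q_def P_def h_def g_def)
  consider "n < length v" | "n = length v" | "n > length v" by linarith
  then show "sum_list (take n (v @ w)) * int (length (v @ w)) < int n * sum_list (v @ w) \<and>
     int n * sum_list (v @ w) < (sum_list (take n (v @ w)) + 1) * int (length (v @ w))"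
  proof cases
    case 1
    define k m where "k = sum_list (take n v)" and "m = int n"
    have k: "k * Q < m * h" "m * h < (k + 1) * Q" and m: "0 < m" "m < Q"
      using v n 1 by (auto simp: christoffel_def k_def Q_def h_def m_def)
    have "(k * Q) * (Q + P) < (m * h) * (Q + P)" using k(1) pos by simp
    also have "\<dots> < m * (h * Q + h * P + 1)" using m by (simp add: algebra_simps)
    also have "\<dots> = m * (h + g) * Q" using det by algebra
    finally have "Q * (k * (Q + P)) < Q * (m * (h + g))" by (simp add: algebra_simps)
    then have 1: "k * (Q + P) < m * (h + g)" using pos by simp
    have "m * (h + g) * Q = (m * h) * (Q + P) + m" using det by algebra
    \<comment> \<open>Integrality gains 1 in the bound for \<open>v\<close>. After multiplication by
      Q + P this outweighs the error term m < Q.\<close>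
    also have "\<dots> \<le> ((k + 1) * Q - 1) * (Q + P) + m" using k(2) pos by (intro add_right_mono mult_right_mono) auto
    also have "\<dots> < (k + 1) * Q * (Q + P)" using m pos by (simp add: algebra_simps)
    finally have "Q * (m * (h + g)) < Q * ((k + 1) * (Q + P))" by (simp add: algebra_simps)
    then have 2: "m * (h + g) < (k + 1) * (Q + P)" using pos by simp
    show ?thesis using 1 2 \<open>n < length v\<close> by (simp only: eqs) (simp add: k_def m_def)
  next
    case 2
    have 1: "h * (Q + P) < Q * (h + g)" "Q * (h + g) < (h + 1) * (Q + P)"
      using det pos by (auto simp: algebra_simps)
    show ?thesis using 1 2 by (simp only: eqs) (simp add: h_def Q_def)
  next
    case 3
    define j where "j = n - length v"
    have j: "0 < j \<and> j < length w" using n 3 by (auto simp: j_def)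
    define k m where "k = sum_list (take j w)" and "m = int j"
    have k: "k * P < m * g" "m * g < (k + 1) * P" and m: "0 < m" "m < P"
      using w[unfolded christoffel_def, rule_format, OF j] j by (auto simp: k_def P_def g_def m_def)
    have g: "g * (Q + P) = (h + g) * P + 1" using det by algebra
    have "(k * P) * (Q + P) \<le> (m * g - 1) * (Q + P)" using k(1) pos by (intro mult_right_mono) auto
    also have "\<dots> = m * (h + g) * P + m - (Q + P)" using g by algebra
    also have "\<dots> < m * (h + g) * P" using m pos by simp
    finally have "P * (k * (Q + P)) < P * (m * (h + g))" by (simp add: algebra_simps)
    then have "k * (Q + P) < m * (h + g)" using pos by simp
    moreover have "Q * (h + g) = h * (Q + P) + 1" using det by algebra
    ultimately have 1: "(h + k) * (Q + P) < (Q + m) * (h + g)" by (simp add: algebra_simps)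
    have "P * (m * (h + g)) + m = m * g * (Q + P)" using g by algebra
    also have "\<dots> \<le> ((k + 1) * P - 1) * (Q + P)" using k(2) pos by (intro mult_right_mono) auto
    finally have "P * (m * (h + g) + 1) < P * ((k + 1) * (Q + P))"
      using m pos by (simp add: algebra_simps)
    then have "m * (h + g) + 1 < (k + 1) * (Q + P)" using pos by simp
    then have 2: "(Q + m) * (h + g) < (h + k + 1) * (Q + P)"
      using \<open>Q * (h + g) = h * (Q + P) + 1\<close> by (simp add: algebra_simps)
    have e: "sum_list (take n (v @ w)) = h + k" "int n = Q + m"
      using 3 by (simp_all add: h_def k_def j_def Q_def m_def)
    show ?thesis unfolding e eqs using 1 2 by simp
  qed
qed

lemma christoffel_replicate_lower:
  assumes "b = a + 1"
  shows "christoffel (a # replicate k a @ [b])"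
  unfolding christoffel_def
proof (intro allI impI)
  fix n assume n: "0 < n \<and> n < length (a # replicate k a @ [b])"
  then have e: "take n (a # replicate k a @ [b]) = replicate n a"
    by (cases n) (auto simp: min_def)
  show "sum_list (take n (a # replicate k a @ [b])) * int (length (a # replicate k a @ [b])) < int n * sum_list (a # replicate k a @ [b]) \<and>
         int n * sum_list (a # replicate k a @ [b]) < (sum_list (take n (a # replicate k a @ [b])) + 1) * int (length (a # replicate k a @ [b]))"
    using n unfolding e by (simp add: sum_list_replicate assms algebra_simps)
qed

lemma christoffel_replicate_upper:
  assumes "b = a + 1"
  shows "christoffel (a # replicate k b @ [b])"
  unfolding christoffel_def
proof (intro allI impI)
  fix n assume n: "0 < n \<and> n < length (a # replicate k b @ [b])"
  then obtain m where m: "n = Suc m" "m \<le> k" by (cases n) auto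
  then have e: "take n (a # replicate k b @ [b]) = a # replicate m b"
    by (auto simp: min_def)
  show "sum_list (take n (a # replicate k b @ [b])) * int (length (a # replicate k b @ [b])) < int n * sum_list (a # replicate k b @ [b]) \<and>
         int n * sum_list (a # replicate k b @ [b]) < (sum_list (take n (a # replicate k b @ [b])) + 1) * int (length (a # replicate k b @ [b]))"
    using m unfolding e by (simp add: sum_list_replicate assms algebra_simps)
qed

section \<open>Central words\<close>

lemma append_Cons_commute_replicate: "xs @ [c] = c # xs \<Longrightarrow> xs = replicate (length xs) c"
  by (induction xs) auto

lemma append_eq_append_longer:
  "xs @ ys = zs @ ts \<Longrightarrow> length zs \<le> length xs \<Longrightarrow> \<exists>r. xs = zs @ r \<and> r @ ys = ts"
  by (auto simp: append_eq_append_conv2)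

text \<open>A Euclidean algorithm on the lengths. If they differ by at least two, the equation
  splits the longer word into the shorter one, two letters and a palindrome \<open>r\<close>, and
  the pair with \<open>r\<close> in place of the longer word satisfies the same equation with the
  same determinant. The descent ends at two powers of one letter whose lengths differ by
  one.\<close>

lemma palindromic_pair:
  assumes "p @ [a, b] @ q = q @ [b, a] @ p" "palindrome p" "palindrome q"
    and "set p \<subseteq> {a, b}" "set q \<subseteq> {a, b}" and ab: "b = a + 1"
  shows "central a b p \<and> central a b q \<and>
    christoffel (a # p @ [b]) \<and> christoffel (a # q @ [b]) \<and>
    sum_list (a # p @ [b]) * int (length q + 2) - sum_list (a # q @ [b]) * int (length p + 2) = 1"
  using assms(1-5)
proof (induction "length p + length q" arbitrary: p q rule: less_induct)
  case less
  consider "length p = length q" | "length p = length q + 1" | "length q = length p + 1"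
    | "length p \<ge> length q + 2" | "length q \<ge> length p + 2" by linarith
  then show ?case
  proof cases
    case 1
    then have "[a, b] @ q = [b, a] @ p" using less.prems(1) append_eq_append_conv by blast
    then show ?thesis using ab by simp
  next
    case 2
    have "p @ ([a, b] @ q) = (q @ [b]) @ (a # p)" using less.prems(1) by simp
    \<comment> \<open>Both p = qb and p = bq hold, so q commutes with the letter b and is a power of
      it.\<close>
    then have "p = q @ [b]" "[a, b] @ q = a # p" using 2 append_eq_append_conv[of p "q @ [b]"] by simp_all
    then have q: "q = replicate (length q) b" and p: "p = b # q"
      using append_Cons_commute_replicate[of q b] by auto
    define m where "m = length q"
    have q: "q = replicate m b" and p: "p = replicate (Suc m) b" using p q by (auto simp: m_def)
    have "letter_power p" "letter_power q" unfolding p q letter_power_def by blast+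
    then show ?thesis using less.prems ab
      christoffel_replicate_upper[OF ab, of m] christoffel_replicate_upper[OF ab, of "Suc m"] unfolding p q
      by (simp add: central_def sum_list_replicate algebra_simps)
  next
    case 3
    have "(p @ [a]) @ (b # q) = q @ ([b, a] @ p)" using less.prems(1) by simp
    then have "q = p @ [a]" "[b, a] @ p = b # q" using 3 append_eq_append_conv[of "p @ [a]" q] by simp_all
    then have p: "p = replicate (length p) a" and q: "q = a # p"
      using append_Cons_commute_replicate[of p a] by auto
    define m where "m = length p"
    have p: "p = replicate m a" and q: "q = replicate (Suc m) a" using p q by (auto simp: m_def)
    have "letter_power p" "letter_power q" unfolding p q letter_power_def by blast+
    then show ?thesis using less.prems ab
      christoffel_replicate_lower[OF ab, of m] christoffel_replicate_lower[OF ab, of "Suc m"] unfolding p q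
      by (simp add: central_def sum_list_replicate algebra_simps)
  next
    case 4
    have "p @ ([a, b] @ q) = (q @ [b, a]) @ p" using less.prems(1) by simp
    then obtain r where r: "p = (q @ [b, a]) @ r" "r @ ([a, b] @ q) = p"
      using append_eq_append_longer 4 by (metis length_append length_Cons list.size(3) numeral_2_eq_2)
    \<comment> \<open>Reversing p = q ba r and comparing with p = r ab q shows that r is a
      palindrome.\<close>
    have "rev p = rev r @ [a, b] @ q" using r(1) less.prems(3) by (simp add: palindrome_def)
    also have "rev p = r @ [a, b] @ q" using less.prems(2) r(2) by (simp add: palindrome_def)
    finally have rp: "palindrome r" by (simp add: palindrome_def)
    have "set r \<subseteq> {a, b}" using r(2) less.prems(4) by auto
    with less.hyps[of r q] r rp less.prems
    have IH: "central a b q" "christoffel (a # r @ [b])" "christoffel (a # q @ [b])"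
      "sum_list (a # r @ [b]) * int (length q + 2) - sum_list (a # q @ [b]) * int (length r + 2) = 1"
      by auto
    \<comment> \<open>Because p = q ba r, the word apb is the product of aqb and arb.\<close>
    have "christoffel ((a # q @ [b]) @ (a # r @ [b]))"
      by (rule christoffel_append) (use IH in auto)
    then have "christoffel (a # p @ [b])" by (simp add: r(1))
    moreover have "central a b p"
      unfolding central_def using less.prems(2-4) rp r(2) by metis
    moreover have "sum_list (a # p @ [b]) * int (length q + 2) - sum_list (a # q @ [b]) * int (length p + 2) = 1"
      using IH(4) r(1) by (simp add: algebra_simps)
    ultimately show ?thesis using IH by blast
  next
    case 5
    have "q @ ([b, a] @ p) = (p @ [a, b]) @ q" using less.prems(1) by simp
    then obtain r where r: "q = (p @ [a, b]) @ r" "q = r @ ([b, a] @ p)"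
      using append_eq_append_longer 5 by (metis length_append length_Cons list.size(3) numeral_2_eq_2)
    have "rev q = rev r @ [b, a] @ p" using r(1) less.prems(2) by (simp add: palindrome_def)
    also have "rev q = r @ [b, a] @ p" using less.prems(3) r(2) by (simp add: palindrome_def)
    finally have rp: "palindrome r" by (simp add: palindrome_def)
    have "set r \<subseteq> {a, b}" using r(2) less.prems(5) by auto
    with less.hyps[of p r] r rp less.prems
    have IH: "central a b p" "christoffel (a # p @ [b])" "christoffel (a # r @ [b])"
      "sum_list (a # p @ [b]) * int (length r + 2) - sum_list (a # r @ [b]) * int (length p + 2) = 1"
      by auto
    have "christoffel ((a # r @ [b]) @ (a # p @ [b]))"
      by (rule christoffel_append) (use IH in auto)
    then have "christoffel (a # q @ [b])" by (simp add: r(2))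
    moreover have "central a b q"
      unfolding central_def using less.prems(2,3,5) rp r(1) by (metis append_assoc)
    moreover have "sum_list (a # p @ [b]) * int (length q + 2) - sum_list (a # q @ [b]) * int (length p + 2) = 1"
      using IH(4) r(2) by (simp add: algebra_simps)
    ultimately show ?thesis using IH by blast
  qed
qed

section \<open>Decompositions of central words\<close>

lemma central_palindrome: "central a b w \<Longrightarrow> palindrome w"
  by (auto simp: central_def letter_power_def palindrome_def)

text \<open>Reversing the palindrome u = x ab y gives u = y ba x, and with both factorizations
  \<open>palindromic_pair\<close> upgrades the palindromes x and y to central words.\<close>

lemma central_decomp_exists:
  assumes "central a b u" "\<not> letter_power u" "b = a + 1"
  shows "\<exists>p q. central_decomp a b u p q"
proof -
  obtain x y where xy: "palindrome x" "palindrome y" "u = x @ [a, b] @ y"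
    using assms by (auto simp: central_def)
  then have "rev u = y @ [b, a] @ x" by (simp add: palindrome_def)
  moreover have "rev u = u" using central_palindrome[OF assms(1)] by (simp add: palindrome_def)
  ultimately have u: "u = y @ [b, a] @ x" by simp
  have "set u \<subseteq> {a, b}" using assms by (simp add: central_def)
  then have "central a b x \<and> central a b y"
    using palindromic_pair[of x a b y] xy u assms by auto
  then show ?thesis using xy u unfolding central_decomp_def by blast
qed

text \<open>Since u = q ba p, the word aub is the product of aqb and apb, whose determinant is
  exactly what \<open>christoffel_append\<close> asks for.\<close>

lemma central_decomp_det:
  assumes "central_decomp a b u p q" "b = a + 1"
  shows "sum_list (a # p @ [b]) * int (length q + 2) - sum_list (a # q @ [b]) * int (length p + 2) = 1"
    and "christoffel (a # u @ [b])"
proof -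
  have eq: "p @ [a, b] @ q = q @ [b, a] @ p" and p: "central a b p" and q: "central a b q"
    using assms(1) unfolding central_decomp_def by metis+
  then have "set p \<subseteq> {a, b}" "set q \<subseteq> {a, b}" by (auto simp: central_def)
  from palindromic_pair[OF eq central_palindrome[OF p] central_palindrome[OF q] this assms(2)]
  have *: "christoffel (a # p @ [b])" "christoffel (a # q @ [b])"
    and det: "sum_list (a # p @ [b]) * int (length q + 2) - sum_list (a # q @ [b]) * int (length p + 2) = 1"
    by blast+
  have "christoffel ((a # q @ [b]) @ (a # p @ [b]))"
    by (rule christoffel_append) (use * det in auto)
  moreover have "u = q @ [b, a] @ p" using assms(1) unfolding central_decomp_def by blast
  ultimately show "christoffel (a # u @ [b])" by simp
  show "sum_list (a # p @ [b]) * int (length q + 2) - sum_list (a # q @ [b]) * int (length p + 2) = 1"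
    by (fact det)
qed

lemma central_christoffel:
  assumes "central a b u" "b = a + 1"
  shows "christoffel (a # u @ [b])"
proof (cases "letter_power u")
  case True
  then obtain c k where u: "u = replicate k c" by (auto simp: letter_power_def)
  moreover have "set u \<subseteq> {a, b}" using assms by (simp add: central_def)
  ultimately have "k = 0 \<or> c = a \<or> c = b" by (auto split: if_splits)
  then show ?thesis
    using u christoffel_replicate_lower[OF assms(2), of k] christoffel_replicate_upper[OF assms(2), of k]
    by auto
next
  case False
  then show ?thesis using central_decomp_exists[of a b u] central_decomp_det assms by blast
qed

text \<open>The determinant, rewritten in terms of N = |u| + 2 and the digit sum H of aub, says that
  |p| + 2 is the inverse of -H modulo N. Its size is less than N, so |p| is determined by u.\<close>

lemma central_decomp_unique:
  assumes d: "central_decomp a b u p q" and d': "central_decomp a b u p' q'" and ab: "b = a + 1"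
  shows "p = p' \<and> q = q'"
proof -
  define N H where "N = int (length u + 2)" and "H = sum_list (a # u @ [b])"
  have key: "\<exists>g. g * N - H * (int (length x) + 2) = 1" if "central_decomp a b u x y" for x y
  proof -
    have u: "u = x @ [a, b] @ y" using that unfolding central_decomp_def by blast
    show ?thesis
      using central_decomp_det(1)[OF that ab] unfolding N_def H_def u
      by (intro exI[of _ "sum_list (a # x @ [b])"]) (simp add: algebra_simps)
  qed
  obtain g where g: "g * N - H * (int (length p) + 2) = 1" using key[OF d] by blast
  obtain g' where g': "g' * N - H * (int (length p') + 2) = 1" using key[OF d'] by blast
  define P P' where "P = int (length p) + 2" and "P' = int (length p') + 2"
  \<comment> \<open>Subtracting \<open>g\<close> and \<open>g'\<close> gives H(P - P') = N(g - g').
    Multiplying P - P' by 1 = gN - HP then leaves only multiples of N.\<close>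
  have "P - P' = N * (g * (P - P') - P * (g - g'))"
    using g g' unfolding P_def[symmetric] P'_def[symmetric] by algebra
  then have "N dvd P - P'" by (metis dvd_triv_left)
  moreover have lens: "\<bar>P - P'\<bar> < N"
  proof -
    have "u = p @ [a, b] @ q" "u = p' @ [a, b] @ q'"
      using d d' unfolding central_decomp_def by blast+
    then have "length u = length p + length q + 2" "length u = length p' + length q' + 2"
      by (metis add.assoc add.commute length_append length_Cons list.size(3) add_2_eq_Suc' One_nat_def plus_1_eq_Suc)+
    then show ?thesis by (auto simp: P_def P'_def N_def)
  qed
  ultimately have "P = P'" using zdvd_imp_le[of N "\<bar>P - P'\<bar>"] by (cases "P = P'") auto
  then have "length p = length p'" by (simp add: P_def P'_def)
  moreover have "p @ ([a, b] @ q) = p' @ ([a, b] @ q')" using d d' unfolding central_decomp_def by metis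
  ultimately show ?thesis by simp
qed

text \<open>Write n = mN + r with r < N. The m full periods contribute mH, and the Christoffel
  condition says that the prefix of length r has sum floor(rH/N).\<close>

lemma christoffel_cycle_lower:
  assumes "christoffel w" "w \<noteq> []"
  shows "cycle w = lower_mech (real_of_int (sum_list w) / real (length w))"
proof (rule lower_mech_eqI)
  fix n
  define N H r m where "N = length w" and "H = sum_list w" and "r = n mod N" and "m = n div N"
  have N: "N > 0" using assms by (simp add: N_def)
  define S where "S = sum_list (take r w)"
  have r: "r < N" using N by (simp add: r_def)
  have S: "S * int N \<le> int r * H" "int r * H < (S + 1) * int N"
    using assms(1) r N unfolding christoffel_def S_def N_def H_def by (cases "r = 0"; force)+
  have n: "real n = real m * real N + real r"
    by (metis div_mult_mod_eq m_def r_def of_nat_add of_nat_mult)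
  have e: "real_of_int H / real N * real n = real m * H + real r * H / real N"
    using N unfolding n by (simp add: field_simps)
  have "real_of_int (S * int N) \<le> real_of_int (int r * H)" "real_of_int (int r * H) < real_of_int ((S + 1) * int N)"
    using S by (simp_all only: of_int_le_iff of_int_less_iff)
  then have "real_of_int S \<le> real r * H / real N" "real r * H / real N < S + 1"
    using N by (simp_all add: field_simps)
  then have "\<lfloor>real_of_int H / real N * real n\<rfloor> = int m * H + S"
    unfolding e by (intro floor_unique) auto
  then show "psum (cycle w) n = \<lfloor>real_of_int (sum_list w) / real (length w) * real n\<rfloor>"
    using psum_cycle[OF assms(2), of n] by (simp add: N_def H_def S_def m_def r_def)
qed

text \<open>A nonempty proper prefix of bua has sum one larger than that of aub. Since both
  Christoffel inequalities are strict, this turns the floor of rH/N into its ceiling for 0 < r <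
  N.\<close>

lemma christoffel_cycle_upper:
  assumes "christoffel (a # u @ [b])" and ab: "b = a + 1"
  shows "cycle (b # u @ [a]) = upper_mech (real_of_int (sum_list (a # u @ [b])) / real (length u + 2))"
proof (rule upper_mech_eqI)
  fix n
  let ?w = "a # u @ [b]"
  define N H r m where "N = length u + 2" and "H = sum_list ?w" and "r = n mod N" and "m = n div N"
  have N: "N > 0" by (simp add: N_def)
  define S where "S = sum_list (take r (b # u @ [a]))"
  have r: "r < N" using N by (simp add: r_def)
  have *: "S = sum_list (take r ?w) + 1" if "r > 0"
    using that r by (cases r) (auto simp: S_def ab N_def)
  have S: "(S - 1) * int N < int r * H" "int r * H \<le> S * int N"
  proof -
    show "(S - 1) * int N < int r * H"
      using assms(1)[unfolded christoffel_def, rule_format, of r] r * N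
      by (cases "r = 0") (auto simp: S_def N_def H_def)
    show "int r * H \<le> S * int N"
      using assms(1)[unfolded christoffel_def, rule_format, of r] r * N
      by (cases "r = 0") (auto simp: S_def N_def H_def)
  qed
  have n: "real n = real m * real N + real r"
    by (metis div_mult_mod_eq m_def r_def of_nat_add of_nat_mult)
  have e: "real_of_int H / real N * real n = real m * H + real r * H / real N"
    using N unfolding n by (simp add: field_simps)
  have "real_of_int ((S - 1) * int N) < real_of_int (int r * H)" "real_of_int (int r * H) \<le> real_of_int (S * int N)"
    using S by (simp_all only: of_int_le_iff of_int_less_iff)
  then have "real_of_int S - 1 < real r * H / real N" "real r * H / real N \<le> S"
    using N by (simp_all add: field_simps)
  then have "\<lceil>real_of_int H / real N * real n\<rceil> = int m * H + S"
    unfolding e by (intro ceiling_unique) auto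
  then show "psum (cycle (b # u @ [a])) n = \<lceil>real_of_int (sum_list ?w) / real (length u + 2) * real n\<rceil>"
    using psum_cycle[of "b # u @ [a]" n] by (simp add: N_def H_def S_def m_def r_def algebra_simps)
qed

text \<open>
  A slope compatible with all prefixes is the supremum \<open>\<alpha>\<close> of the averages \<open>S n / n\<close>; the upper
  word appears when \<open>\<alpha>\<close> coincides with some \<open>(S m + 1) / m\<close>.
\<close>

lemma arbitrarily_long_central_prefixes:
  assumes ab: "b = a + 1"
    and long: "\<And>K. \<exists>u. central a b u \<and> stake (length u) s = u \<and> K \<le> length u"
  shows "\<exists>\<alpha>\<in>{real_of_int a..real_of_int b}. a ## s = lower_mech \<alpha> \<or> b ## s = upper_mech \<alpha>"
proof -
  define S where "S = psum (a ## s)"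
  \<comment> \<open>Both prefixes are proper prefixes of one Christoffel word aub, whose slope lies
    strictly above S n / n and strictly below (S m + 1) / m.\<close>
  have key: "S n * int m < (S m + 1) * int n" if nm: "n > 0" "m > 0" for n m
  proof -
    obtain u where u: "central a b u" "stake (length u) s = u" "max n m \<le> length u"
      using long by blast
    let ?w = "a # u @ [b]"
    define N where "N = int (length ?w)"
    have chr: "christoffel ?w" using central_christoffel u ab by blast
    have S: "S k = sum_list (take k ?w)" if k: "k \<le> length u" for k
    proof (cases k)
      case (Suc j)
      then have "take j u = stake j s" using u(2) k take_stake[of j "length u" s] by (simp add: min_def)
      then show ?thesis using Suc k by (simp add: S_def psum_def)
    qed (simp add: S_def)
    have lt: "n < length ?w" "m < length ?w" using u by auto
    have 1: "S n * N < int n * sum_list ?w"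
      using chr nm lt u S[of n] unfolding christoffel_def N_def by (metis max.boundedE)
    have 2: "int m * sum_list ?w < (S m + 1) * N"
      using chr nm lt u S[of m] unfolding christoffel_def N_def by (metis max.boundedE)
    have "int m * (S n * N) < int m * (int n * sum_list ?w)" using 1 nm by simp
    also have "\<dots> = int n * (int m * sum_list ?w)" by (simp add: algebra_simps)
    also have "\<dots> < int n * ((S m + 1) * N)" using 2 nm by simp
    finally have "N * (S n * int m) < N * ((S m + 1) * int n)" by (simp add: algebra_simps)
    then show ?thesis by (simp add: N_def)
  qed
  have key': "S n / n < (S m + 1) / m" if nm: "n > 0" "m > 0" for n m :: nat
  proof -
    have "real_of_int (S n * int m) < real_of_int ((S m + 1) * int n)"
      using key[OF nm] by (simp only: of_int_less_iff)
    then show ?thesis using nm by (simp add: field_simps)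
  qed
  define A where "A = (\<lambda>n. S n / real n) ` {0<..}"
  define \<alpha> where "\<alpha> = Sup A"
  have bdd: "bdd_above A"
    unfolding A_def
  proof (rule bdd_aboveI2)
    show "S n / real n \<le> (S 1 + 1) / real 1" if "n \<in> {0<..}" for n
      using key'[of n 1] that by simp
  qed
  have lo: "S n / n \<le> \<alpha>" if "n > 0" for n :: nat
    unfolding \<alpha>_def using that by (intro cSup_upper bdd) (auto simp: A_def)
  have hi: "\<alpha> \<le> (S m + 1) / m" if "m > 0" for m :: nat
    unfolding \<alpha>_def A_def using key' that by (intro cSUP_least less_imp_le) auto
  have S1: "S 1 = a" by (simp add: S_def psum_def)
  have "\<alpha> \<in> {real_of_int a..real_of_int b}"
    using lo[of 1] hi[of 1] S1 ab by auto
  moreover have "a ## s = lower_mech \<alpha> \<or> b ## s = upper_mech \<alpha>"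
  proof (cases "\<exists>m>0. \<alpha> = (S m + 1) / real m")
    case False
    have "a ## s = lower_mech \<alpha>"
    proof (rule lower_mech_eqI)
      fix n
      show "psum (a ## s) n = \<lfloor>\<alpha> * real n\<rfloor>"
      proof (cases "n = 0")
        case n: False
        then have "\<alpha> < (S n + 1) / real n" using hi[of n] False by (metis order_le_less neq0_conv)
        then have "S n \<le> \<alpha> * n" "\<alpha> * n < S n + 1" using lo[of n] n by (simp_all add: field_simps)
        then show ?thesis unfolding S_def by linarith
      qed simp
    qed
    then show ?thesis ..
  next
    case True
    then obtain m where m: "m > 0" "\<alpha> = (S m + 1) / real m" by blast
    have "b ## s = upper_mech \<alpha>"
    proof (rule upper_mech_eqI)
      fix n
      show "psum (b ## s) n = \<lceil>\<alpha> * real n\<rceil>"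
      proof (cases n)
        case (Suc k)
        \<comment> \<open>Applying \<open>key'\<close> with the m at which the upper bound is
          attained makes the lower bound strict, so S n + 1 is the ceiling.\<close>
        have "S n / n < \<alpha>" using key'[of n m] Suc m by simp
        then have "S n < \<alpha> * n" "\<alpha> * n \<le> S n + 1" using hi[of n] Suc by (simp_all add: field_simps)
        moreover have "psum (b ## s) n = S n + 1" using Suc ab by (simp add: S_def)
        ultimately show ?thesis by linarith
      qed simp
    qed
    then show ?thesis ..
  qed
  ultimately show ?thesis by blast
qed

section \<open>Words all of whose shifts lie in an interval\<close>

lemma psum_sdrop_upper_mech:
  "psum (sdrop j (upper_mech \<alpha>)) n = \<lceil>\<alpha> * j + \<alpha> * n\<rceil> - \<lceil>\<alpha> * j\<rceil>"
  using psum_add[of "upper_mech \<alpha>" j n] by (simp add: psum_upper_mech algebra_simps)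

text \<open>A factor of length n of the upper word has sum between the floor and the ceiling of
  alpha n, and \<open>psum_le_imp_word_le\<close> turns bounds on sums into lexicographic
  ones.\<close>

lemma sdrop_upper_mech_between:
  "lower_mech \<alpha> \<le>\<^sub>l\<^sub>e\<^sub>x sdrop j (upper_mech \<alpha>)" "sdrop j (upper_mech \<alpha>) \<le>\<^sub>l\<^sub>e\<^sub>x upper_mech \<alpha>"
proof -
  have "\<lfloor>y\<rfloor> \<le> \<lceil>x + y\<rceil> - \<lceil>x\<rceil>" "\<lceil>x + y\<rceil> - \<lceil>x\<rceil> \<le> \<lceil>y\<rceil>" for x y :: real
    by linarith+
  then show "lower_mech \<alpha> \<le>\<^sub>l\<^sub>e\<^sub>x sdrop j (upper_mech \<alpha>)" "sdrop j (upper_mech \<alpha>) \<le>\<^sub>l\<^sub>e\<^sub>x upper_mech \<alpha>"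
    by (auto intro!: psum_le_imp_word_le simp: psum_sdrop_upper_mech psum_lower_mech psum_upper_mech)
qed

text \<open>When all shifts are bounded, lexicographic bounds conversely yield bounds on sums. At
  the first difference from the lower word a shift has gained at least 1, which pays for the defect
  in floor(x + y) <= floor x + floor y + 1 when the remaining letters are handled by
  induction.\<close>

lemma floor_le_psum_shift:
  assumes "\<And>j. lower_mech \<alpha> \<le>\<^sub>l\<^sub>e\<^sub>x sdrop j w"
  shows "\<lfloor>\<alpha> * n\<rfloor> \<le> psum (sdrop j w) n"
proof (induction n arbitrary: j rule: less_induct)
  case (less n)
  let ?L = "lower_mech \<alpha>" and ?v = "sdrop j w"
  show ?case
  proof (cases "?L = ?v")
    case True
    then show ?thesis using psum_lower_mech[of \<alpha> n] by simp
  next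
    case False
    with assms[of j] obtain k where k: "\<forall>i<k. ?L !! i = ?v !! i" "?L !! k < ?v !! k"
      by (auto simp: word_le_def word_less_def)
    have eq: "psum ?L m = psum ?v m" if "m \<le> k" for m
      using k that by (simp add: psum_eq_sum)
    show ?thesis
    proof (cases "n \<le> k")
      case True
      then show ?thesis using eq[of n] psum_lower_mech[of \<alpha> n] by simp
    next
      case False
      then obtain m where n: "n = Suc k + m" by (metis not_less_eq_eq le_iff_add)
      have "psum ?v n = psum ?v (Suc k) + psum (sdrop (j + Suc k) w) m"
        unfolding n psum_add by simp
      moreover have "\<lfloor>\<alpha> * m\<rfloor> \<le> psum (sdrop (j + Suc k) w) m" by (rule less) (simp add: n)
      moreover have "psum ?v (Suc k) \<ge> \<lfloor>\<alpha> * Suc k\<rfloor> + 1"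
        using eq[of k] k(2) psum_lower_mech[of \<alpha> "Suc k"] by (simp add: psum_Suc)
      moreover have "\<lfloor>\<alpha> * Suc k + \<alpha> * m\<rfloor> \<le> \<lfloor>\<alpha> * Suc k\<rfloor> + 1 + \<lfloor>\<alpha> * m\<rfloor>" by linarith
      moreover have "\<alpha> * n = \<alpha> * Suc k + \<alpha> * m" by (simp add: n algebra_simps)
      ultimately show ?thesis by linarith
    qed
  qed
qed

lemma psum_smap_uminus: "psum (smap uminus w) n = - psum w n"
  by (simp add: psum_eq_sum sum_negf)

lemma lower_mech_uminus: "lower_mech (- \<alpha>) = smap uminus (upper_mech \<alpha>)"
  by (rule lower_mech_eqI[symmetric]) (simp add: psum_smap_uminus psum_upper_mech ceiling_def)

lemma psum_shift_le_ceiling: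
  assumes "\<And>j. sdrop j w \<le>\<^sub>l\<^sub>e\<^sub>x upper_mech \<alpha>"
  shows "psum (sdrop j w) n \<le> \<lceil>\<alpha> * n\<rceil>"
proof -
  have "lower_mech (- \<alpha>) \<le>\<^sub>l\<^sub>e\<^sub>x sdrop i (smap uminus w)" for i
    using assms[of i] by (simp add: lower_mech_uminus smap_uminus_le)
  from floor_le_psum_shift[OF this, of n j] show ?thesis
    by (simp add: psum_smap_uminus ceiling_def)
qed

text \<open>Since alpha N is an integer, every window of N letters has sum H, and comparing the
  windows at j and j + 1 gives the period. The lower word is found by starting where the path of
  partial sums is highest above the line of slope alpha; periodicity guarantees that a highest point
  exists.\<close>

lemma trapped_word_periodic:
  assumes L: "\<And>j. lower_mech \<alpha> \<le>\<^sub>l\<^sub>e\<^sub>x sdrop j w" and U: "\<And>j. sdrop j w \<le>\<^sub>l\<^sub>e\<^sub>x upper_mech \<alpha>"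
    and N: "\<alpha> * real N = real_of_int H" "N > 0"
  shows "sdrop N w = w" "\<exists>j. sdrop j w = lower_mech \<alpha>"
proof -
  have lo: "\<lfloor>\<alpha> * n\<rfloor> \<le> psum (sdrop j w) n" for n j by (rule floor_le_psum_shift[OF L])
  have hi: "psum (sdrop j w) n \<le> \<lceil>\<alpha> * n\<rceil>" for n j by (rule psum_shift_le_ceiling[OF U])
  have H: "psum (sdrop j w) N = H" for j using lo[of N j] hi[of j N] N by simp
  show per: "sdrop N w = w"
  proof (rule stream_eqI)
    fix j
    have "psum (sdrop j w) (Suc N) = psum (sdrop j w) N + w !! (j + N)"
      by (simp add: psum_Suc sdrop_snth)
    moreover have "psum (sdrop j w) (1 + N) = w !! j + psum (sdrop (Suc j) w) N"
      by (subst psum_add) (simp add: psum_def)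
    ultimately show "sdrop N w !! j = w !! j" using H[of j] H[of "Suc j"]
      by (simp add: sdrop_snth add.commute del: sdrop.simps)
  qed
  define e where "e n = psum w n - \<alpha> * n" for n
  have eN: "e (m * N + n) = e n" for m n
  proof (induction m)
    case (Suc m)
    have "psum w (N + (m * N + n)) = H + psum w (m * N + n)"
      using psum_add[of w N "m * N + n"] per H[of 0] by simp
    then have "e (Suc m * N + n) = e (m * N + n)"
      using N(1) by (simp add: e_def algebra_simps)
    then show ?case using Suc by simp
  qed simp
  obtain j where j: "j < N" "\<And>i. i < N \<Longrightarrow> e i \<le> e j"
  proof -
    have "Max (e ` {..<N}) \<in> e ` {..<N}" using N by (intro Max_in) auto
    then obtain j where "j < N" "e j = Max (e ` {..<N})" by auto
    then show ?thesis using that by simp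
  qed
  have max: "e n \<le> e j" for n
    using eN[of "n div N" "n mod N"] j(2)[of "n mod N"] N by simp
  \<comment> \<open>Seen from the highest point, the path never rises above the line, and
    \<open>lo\<close> leaves only the floor.\<close>
  have "sdrop j w = lower_mech \<alpha>"
  proof (rule lower_mech_eqI)
    fix n
    have "psum w (j + n) = psum w j + psum (sdrop j w) n" by (rule psum_add)
    then have "real_of_int (psum (sdrop j w) n) \<le> \<alpha> * n"
      using max[of "j + n"] by (simp add: e_def algebra_simps)
    then show "psum (sdrop j w) n = \<lfloor>\<alpha> * real n\<rfloor>" using lo[of n j] by linarith
  qed
  then show "\<exists>j. sdrop j w = lower_mech \<alpha>" ..
qed

section \<open>Shifts of periodic words\<close>

lemma sdrop_mult_period: "sdrop N w = w \<Longrightarrow> sdrop (i * N) w = w"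
proof (induction i)
  case (Suc i)
  have "sdrop (Suc i * N) w = sdrop (i * N) (sdrop N w)" by simp
  then show ?case using Suc by simp
qed simp

lemma periodic_shift_range:
  assumes "sdrop N w = w" "N > 0" "sdrop j w = v"
  shows "range (\<lambda>n. sdrop n w) = range (\<lambda>n. sdrop n v)"
proof (intro equalityI subsetI)
  fix x assume "x \<in> range (\<lambda>n. sdrop n w)"
  then obtain n where n: "x = sdrop n w" by auto
  \<comment> \<open>Going round j extra periods makes the shift at least j, so that it passes
    through \<open>v\<close>.\<close>
  have "x = sdrop (j * N + n) w"
    using sdrop_add[of n "j * N" w] sdrop_mult_period[OF assms(1), of j] n by simp
  also have "\<dots> = sdrop (j * N + n - j) v"
  proof -
    have "j \<le> j * N" using assms(2) by simp
    then have "j + (j * N + n - j) = j * N + n" by (metis le_add_diff_inverse trans_le_add1)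
    then show ?thesis using assms(3) sdrop_add[of "j * N + n - j" j w] by metis
  qed
  finally show "x \<in> range (\<lambda>n. sdrop n v)" by blast
next
  fix x assume "x \<in> range (\<lambda>n. sdrop n v)"
  then show "x \<in> range (\<lambda>n. sdrop n w)" using assms(3) by auto
qed

text \<open>Links the ends of a gap to the bounds on the shifts: the lower end (zab)^omega is za
  followed by (bza)^omega, and the upper end (zba)^omega is zb followed by (azb)^omega.\<close>

lemma cycle_Christoffel_unfold:
  "cycle (d # z @ [c]) = d ## cycle (z @ [c, d])"
  "cycle (z @ [c, d]) = z @- c ## cycle (d # z @ [c])"
proof -
  show 1: "cycle (d # z @ [c]) = d ## cycle (z @ [c, d])" using cycle_Cons[of d "z @ [c]"] by simp
  have "cycle (d # z @ [c]) = (d # z @ [c]) @- cycle (d # z @ [c])" by (rule cycle_decomp) simp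
  then show "cycle (z @ [c, d]) = z @- c ## cycle (d # z @ [c])"
    using 1 by (metis shift.simps shift_append stream.inject)
qed

text \<open>
  Since \<open>s\<close> starts with \<open>za\<close>, a shift above \<open>(bza)\<^sup>\<omega>\<close> must start with \<open>bza\<close>, and the rest is again
  a shift above \<open>(bza)\<^sup>\<omega>\<close>, with an earlier first difference: an infinite descent. A shift below
  \<open>(azb)\<^sup>\<omega>\<close> either descends in the same way or produces a shift above \<open>(bza)\<^sup>\<omega>\<close>.
\<close>

lemma gap_trapped_first_letter:
  assumes ab: "b = a + 1"
    and s: "s = z @- a ## s1" "cycle (z @ [a, b]) <\<^sub>l\<^sub>e\<^sub>x s" "s <\<^sub>l\<^sub>e\<^sub>x cycle (z @ [b, a])"
    and w: "\<And>j. a ## s \<le>\<^sub>l\<^sub>e\<^sub>x sdrop j w" "\<And>j. sdrop j w \<le>\<^sub>l\<^sub>e\<^sub>x b ## s"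
  shows "sdrop j w \<le>\<^sub>l\<^sub>e\<^sub>x cycle (b # z @ [a])" "cycle (a # z @ [b]) \<le>\<^sub>l\<^sub>e\<^sub>x sdrop j w"
proof -
  define U where "U = cycle (b # z @ [a])"
  define L where "L = cycle (a # z @ [b])"
  define N where "N = length z + 2"
  have E: "cycle (z @ [a, b]) = z @- a ## U" and F: "cycle (z @ [b, a]) = z @- b ## L"
    unfolding U_def L_def by (rule cycle_Christoffel_unfold)+
  have U: "U = b ## z @- a ## U" and L: "L = a ## z @- b ## L"
    using E F cycle_Christoffel_unfold(1)[of b z a] cycle_Christoffel_unfold(1)[of a z b]
    by (simp_all add: U_def L_def)
  have tail: "((c # z @ [d]) @- x) !! (N + i) = x !! i" for c d x i
    using shift_snth_ge[of "c # z @ [d]" "N + i" x] by (simp add: N_def)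
  have upper: False if "\<forall>i<k. sdrop j w !! i = U !! i" "U !! k < sdrop j w !! k" for j k
    using that
  proof (induction k arbitrary: j rule: less_induct)
    case (less k)
    obtain c x where v: "sdrop j w = c ## x" by (metis stream.collapse)
    have "U <\<^sub>l\<^sub>e\<^sub>x c ## x" unfolding word_less_def v[symmetric] using less.prems by (intro exI[of _ k]) auto
    then have "b < c \<or> b = c \<and> z @- a ## U <\<^sub>l\<^sub>e\<^sub>x x" by (subst (asm) U) simp
    moreover have "c < b \<or> c = b \<and> x \<le>\<^sub>l\<^sub>e\<^sub>x s" using w(2)[of j] unfolding v by simp
    ultimately have c: "c = b" and x: "(z @ [a]) @- U \<le>\<^sub>l\<^sub>e\<^sub>x x" "x \<le>\<^sub>l\<^sub>e\<^sub>x (z @ [a]) @- s1"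
      \<comment> \<open>After its first letter b, the shift is squeezed between za(bza)^omega and s,
        which both start with za.\<close>
      using s(1) by (auto simp: word_le_def)
    from prefix_between[OF x] obtain x' where x': "x = (z @ [a]) @- x'" by blast
    have v: "sdrop j w = (b # z @ [a]) @- x'" using v c x' by simp
    have U': "U = (b # z @ [a]) @- U" using U by simp
    have "x' = sdrop N (sdrop j w)"
      unfolding v by (simp add: sdrop_shift N_def del: shift.simps(2))
    then have x'2: "x' = sdrop (j + N) w" by simp
    have k: "N \<le> k"
    proof (rule ccontr)
      assume "\<not> N \<le> k"
      then have "k < length (b # z @ [a])" by (simp add: N_def)
      then have "sdrop j w !! k = U !! k"
        by (subst U', subst v) (simp only: shift_snth_less)
      then show False using less.prems(2) by simp
    qed
    have sh: "sdrop j w !! (N + i) = x' !! i" "U !! (N + i) = U !! i" for i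
      using v U' tail by metis+
    obtain k' where k': "k = N + k'" using k le_iff_add by blast
    have "x' !! i = U !! i" if "i < k'" for i
      using less.prems(1)[rule_format, of "N + i"] sh[of i] that k' by simp
    moreover have "U !! k' < x' !! k'" using less.prems(2) sh[of k'] k' by simp
    moreover have "k' < k" using k' by (simp add: N_def)
    ultimately show False using less.IH x'2 by blast
  qed
  then have upper': "sdrop j w \<le>\<^sub>l\<^sub>e\<^sub>x U" for j
    using word_not_le[of "sdrop j w" U] unfolding word_less_def by metis
  have lower: False if "\<forall>i<k. sdrop j w !! i = L !! i" "sdrop j w !! k < L !! k" for j k
    using that
  proof (induction k arbitrary: j rule: less_induct)
    case (less k)
    obtain c x where v: "sdrop j w = c ## x" by (metis stream.collapse)
    have "c ## x <\<^sub>l\<^sub>e\<^sub>x L" unfolding word_less_def v[symmetric] using less.prems by (intro exI[of _ k]) auto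
    then have "c < a \<or> c = a \<and> x <\<^sub>l\<^sub>e\<^sub>x z @- b ## L" by (subst (asm) L) simp
    moreover have "a < c \<or> a = c \<and> s \<le>\<^sub>l\<^sub>e\<^sub>x x" using w(1)[of j] unfolding v by simp
    ultimately have c: "c = a" and sx: "s \<le>\<^sub>l\<^sub>e\<^sub>x x" and x: "z @- a ## s1 \<le>\<^sub>l\<^sub>e\<^sub>x x" "x \<le>\<^sub>l\<^sub>e\<^sub>x z @- b ## L"
      using s(1) by (auto simp: word_le_def)
    from prefix_between[OF x] obtain y where y: "x = z @- y" "a ## s1 \<le>\<^sub>l\<^sub>e\<^sub>x y" "y \<le>\<^sub>l\<^sub>e\<^sub>x b ## L" by blast
    obtain d x' where d: "y = d ## x'" by (metis stream.collapse)
    have v: "sdrop j w = (a # z @ [d]) @- x'" using v c y d by simp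
    have "x' = sdrop N (sdrop j w)"
      unfolding v by (simp add: sdrop_shift N_def del: shift.simps(2))
    then have x'2: "x' = sdrop (j + N) w" by simp
    have "d = a \<or> d = b" using y d ab by auto
    then show False
    proof
      \<comment> \<open>Here x is at least s and hence above za(bza)^omega, so removing za leaves a
        shift above (bza)^omega, which is already excluded.\<close>
      assume "d = a"
      have "z @- a ## U <\<^sub>l\<^sub>e\<^sub>x x" using s(2) sx unfolding E by (rule word_less_le_trans)
      then have "U <\<^sub>l\<^sub>e\<^sub>x x'" using y d \<open>d = a\<close> by simp
      then show False using upper'[of "j + N"] x'2 word_not_le by blast
    next
      assume "d = b"
      then have v: "sdrop j w = (a # z @ [b]) @- x'" using v by simp
      have L': "L = (a # z @ [b]) @- L" using L by simp
      have k: "N \<le> k"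
      proof (rule ccontr)
        assume "\<not> N \<le> k"
        then have "k < length (a # z @ [b])" by (simp add: N_def)
        then have "sdrop j w !! k = L !! k"
          by (subst L', subst v) (simp only: shift_snth_less)
        then show False using less.prems(2) by simp
      qed
      have sh: "sdrop j w !! (N + i) = x' !! i" "L !! (N + i) = L !! i" for i
        using v L' tail by metis+
      obtain k' where k': "k = N + k'" using k le_iff_add by blast
      have "x' !! i = L !! i" if "i < k'" for i
        using less.prems(1)[rule_format, of "N + i"] sh[of i] that k' by simp
      moreover have "x' !! k' < L !! k'" using less.prems(2) sh[of k'] k' by simp
      moreover have "k' < k" using k' by (simp add: N_def)
      ultimately show False using less.IH x'2 by blast
    qed
  qed
  show "sdrop j w \<le>\<^sub>l\<^sub>e\<^sub>x cycle (b # z @ [a])" using upper'[of j] by (simp add: U_def)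
  show "cycle (a # z @ [b]) \<le>\<^sub>l\<^sub>e\<^sub>x sdrop j w"
    using lower[of _ j] word_not_le[of "cycle (a # z @ [b])" "sdrop j w"]
    unfolding word_less_def L_def by metis
qed

text \<open>Inside a gap the letter of s after z is a or b. If it is b, negating all letters makes
  it the smaller one and exchanges the two bounds, so the previous lemma applies.\<close>

lemma gap_trapped:
  assumes ab: "b = a + 1"
    and s: "cycle (z @ [a, b]) <\<^sub>l\<^sub>e\<^sub>x s" "s <\<^sub>l\<^sub>e\<^sub>x cycle (z @ [b, a])"
    and w: "\<And>j. a ## s \<le>\<^sub>l\<^sub>e\<^sub>x sdrop j w" "\<And>j. sdrop j w \<le>\<^sub>l\<^sub>e\<^sub>x b ## s"
  shows "sdrop j w \<le>\<^sub>l\<^sub>e\<^sub>x cycle (b # z @ [a])" "cycle (a # z @ [b]) \<le>\<^sub>l\<^sub>e\<^sub>x sdrop j w"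
proof -
  have "z @- a ## cycle (b # z @ [a]) \<le>\<^sub>l\<^sub>e\<^sub>x s" "s \<le>\<^sub>l\<^sub>e\<^sub>x z @- b ## cycle (a # z @ [b])"
    using s by (simp_all add: cycle_Christoffel_unfold(2) word_le_def)
  from prefix_between[OF this] obtain y where y: "s = z @- y"
    "a ## cycle (b # z @ [a]) \<le>\<^sub>l\<^sub>e\<^sub>x y" "y \<le>\<^sub>l\<^sub>e\<^sub>x b ## cycle (a # z @ [b])" by blast
  obtain d s1 where d: "y = d ## s1" by (metis stream.collapse)
  have "d = a \<or> d = b" using y d ab by auto
  then have "sdrop j w \<le>\<^sub>l\<^sub>e\<^sub>x cycle (b # z @ [a]) \<and> cycle (a # z @ [b]) \<le>\<^sub>l\<^sub>e\<^sub>x sdrop j w"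
  proof
    assume "d = a"
    then show ?thesis using gap_trapped_first_letter[OF ab, of s z s1 w j] y(1) d s w by blast
  next
    assume "d = b"
    let ?m = "smap uminus :: int stream \<Rightarrow> int stream" and ?z = "map uminus z"
    have 1: "cycle (?z @ [- b, - a]) <\<^sub>l\<^sub>e\<^sub>x ?m s"
      using s(2) smap_uminus_less[of "cycle (z @ [b, a])" s] by (simp add: smap_cycle)
    have 2: "?m s <\<^sub>l\<^sub>e\<^sub>x cycle (?z @ [- a, - b])"
      using s(1) smap_uminus_less[of s "cycle (z @ [a, b])"] by (simp add: smap_cycle)
    have 3: "?m s = ?z @- (- b) ## ?m s1" using y(1) d \<open>d = b\<close> by simp
    have 4: "- b ## ?m s \<le>\<^sub>l\<^sub>e\<^sub>x sdrop j (?m w)" "sdrop j (?m w) \<le>\<^sub>l\<^sub>e\<^sub>x - a ## ?m s" for j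
      using w[of j] smap_uminus_le[of "b ## s" "sdrop j w"] smap_uminus_le[of "sdrop j w" "a ## s"]
      by auto
    have "sdrop j (?m w) \<le>\<^sub>l\<^sub>e\<^sub>x cycle (- a # ?z @ [- b])" "cycle (- b # ?z @ [- a]) \<le>\<^sub>l\<^sub>e\<^sub>x sdrop j (?m w)"
      using gap_trapped_first_letter[of "- a" "- b" "?m s" ?z "?m s1" "?m w" j] ab 1 2 3 4 by auto
    then show ?thesis
      using smap_uminus_le[of "sdrop j w" "cycle (a # z @ [b])"] smap_uminus_le[of "cycle (b # z @ [a])" "sdrop j w"]
      by (simp add: smap_cycle)
  qed
  then show "sdrop j w \<le>\<^sub>l\<^sub>e\<^sub>x cycle (b # z @ [a])" "cycle (a # z @ [b]) \<le>\<^sub>l\<^sub>e\<^sub>x sdrop j w" by blast+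
qed

lemma christoffel_shifts_between:
  assumes "christoffel (a # z @ [b])" "b = a + 1"
  shows "cycle (a # z @ [b]) \<le>\<^sub>l\<^sub>e\<^sub>x sdrop j (cycle (b # z @ [a]))"
    and "sdrop j (cycle (b # z @ [a])) \<le>\<^sub>l\<^sub>e\<^sub>x cycle (b # z @ [a])"
  using sdrop_upper_mech_between[where j = j and \<alpha> = "real_of_int (sum_list (a # z @ [b])) / real (length z + 2)"]
    christoffel_cycle_lower[OF assms(1)] christoffel_cycle_upper[OF assms] by simp_all

text \<open>Both w and (bza)^omega are trapped periodic words, so each has the same set of shifts as
  the lower mechanical word (azb)^omega.\<close>

lemma christoffel_trapped_range:
  assumes chr: "christoffel (a # z @ [b])" and ab: "b = a + 1"
    and w: "\<And>j. cycle (a # z @ [b]) \<le>\<^sub>l\<^sub>e\<^sub>x sdrop j w" "\<And>j. sdrop j w \<le>\<^sub>l\<^sub>e\<^sub>x cycle (b # z @ [a])"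
  shows "range (\<lambda>n. sdrop n w) = range (\<lambda>n. sdrop n (cycle (b # z @ [a])))"
proof -
  define N H \<alpha> where "N = length z + 2" and "H = sum_list (a # z @ [b])" and "\<alpha> = real_of_int H / real N"
  have L: "cycle (a # z @ [b]) = lower_mech \<alpha>" and U: "cycle (b # z @ [a]) = upper_mech \<alpha>"
    using christoffel_cycle_lower[OF chr] christoffel_cycle_upper[OF chr ab]
    by (simp_all add: \<alpha>_def N_def H_def)
  have N: "\<alpha> * real N = real_of_int H" "N > 0" by (simp_all add: \<alpha>_def N_def)
  have *: "range (\<lambda>n. sdrop n v) = range (\<lambda>n. sdrop n (lower_mech \<alpha>))"
    if "\<And>j. lower_mech \<alpha> \<le>\<^sub>l\<^sub>e\<^sub>x sdrop j v" "\<And>j. sdrop j v \<le>\<^sub>l\<^sub>e\<^sub>x upper_mech \<alpha>" for v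
    using trapped_word_periodic[OF that N] periodic_shift_range[of N v] N(2) by blast
  show ?thesis
    using *[of w] *[of "upper_mech \<alpha>"] w unfolding L U by (simp add: sdrop_upper_mech_between)
qed

section \<open>Expansions and orbit closures\<close>

lemma angle_frac_eq: "angle_frac x = x - of_int \<lceil>x\<rceil> + 1"
proof (cases "x \<in> \<int>")
  case True
  then show ?thesis by (auto simp: angle_frac_def elim: Ints_cases)
next
  case False
  then have "\<lceil>x\<rceil> = \<lfloor>x\<rfloor> + 1" unfolding ceiling_altdef by (metis Ints_of_int)
  then show ?thesis using False by (simp add: angle_frac_def frac_def)
qed

lemma bar_T_pos: "0 < bar_T \<beta> x" and bar_T_le_1: "bar_T \<beta> x \<le> 1"
  unfolding bar_T_def angle_frac_eq by linarith+

lemma bar_expansion_Cons: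
  "bar_expansion \<beta> x = (\<lceil>\<beta> * x\<rceil> - 1) ## bar_expansion \<beta> (bar_T \<beta> x)"
proof (rule stream_eqI)
  fix n
  show "bar_expansion \<beta> x !! n = ((\<lceil>\<beta> * x\<rceil> - 1) ## bar_expansion \<beta> (bar_T \<beta> x)) !! n"
    by (cases n) (simp_all add: bar_expansion_def funpow_swap1)
qed

lemma mult_eq_digit_plus_bar_T: "\<beta> * x = of_int (\<lceil>\<beta> * x\<rceil> - 1) + bar_T \<beta> x"
  by (simp add: bar_T_def angle_frac_eq)

lemma sdrop_bar_expansion: "sdrop n (bar_expansion \<beta> x) = bar_expansion \<beta> ((bar_T \<beta> ^^ n) x)"
proof (induction n arbitrary: x)
  case (Suc n)
  have "sdrop (Suc n) (bar_expansion \<beta> x) = sdrop n (bar_expansion \<beta> (bar_T \<beta> x))"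
    by (subst bar_expansion_Cons) simp
  then show ?case using Suc by (simp add: funpow_swap1)
qed simp

text \<open>Each equal digit passes the comparison to the images under \<open>bar_T\<close>. At the
  first difference the two products with beta have different ceilings.\<close>

lemma bar_expansion_less_imp_less:
  assumes "\<beta> > 1" "bar_expansion \<beta> x <\<^sub>l\<^sub>e\<^sub>x bar_expansion \<beta> y"
  shows "x < y"
proof -
  have "x < y" if "\<forall>i<k. bar_expansion \<beta> x !! i = bar_expansion \<beta> y !! i"
    "bar_expansion \<beta> x !! k < bar_expansion \<beta> y !! k" for k
    using that
  proof (induction k arbitrary: x y)
    case 0
    then have "\<lceil>\<beta> * x\<rceil> < \<lceil>\<beta> * y\<rceil>" by (simp add: bar_expansion_def)
    then have "\<beta> * x < \<beta> * y" by linarith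
    then show ?case using assms(1) by simp
  next
    case (Suc k)
    note E = bar_expansion_Cons[of \<beta> x] bar_expansion_Cons[of \<beta> y]
    have "\<lceil>\<beta> * x\<rceil> = \<lceil>\<beta> * y\<rceil>" using Suc.prems(1)[rule_format, of 0] by (simp add: bar_expansion_def)
    moreover have "bar_T \<beta> x < bar_T \<beta> y"
    proof (rule Suc.IH)
      show "\<forall>i<k. bar_expansion \<beta> (bar_T \<beta> x) !! i = bar_expansion \<beta> (bar_T \<beta> y) !! i"
      proof (intro allI impI)
        fix i assume "i < k"
        then show "bar_expansion \<beta> (bar_T \<beta> x) !! i = bar_expansion \<beta> (bar_T \<beta> y) !! i"
          using Suc.prems(1)[rule_format, of "Suc i"] E by (metis Suc_mono snth_Stream)
      qed
      show "bar_expansion \<beta> (bar_T \<beta> x) !! k < bar_expansion \<beta> (bar_T \<beta> y) !! k"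
        using Suc.prems(2) E by (metis snth_Stream)
    qed
    ultimately have "\<beta> * x < \<beta> * y"
      using mult_eq_digit_plus_bar_T[of \<beta> x] mult_eq_digit_plus_bar_T[of \<beta> y] by simp
    then show ?case using assms(1) by simp
  qed
  then show ?thesis using assms(2) unfolding word_less_def by blast
qed

lemma bar_expansion_mono:
  "\<beta> > 1 \<Longrightarrow> x \<le> y \<Longrightarrow> bar_expansion \<beta> x \<le>\<^sub>l\<^sub>e\<^sub>x bar_expansion \<beta> y"
  using bar_expansion_less_imp_less[of \<beta> y x] word_not_le by fastforce

text \<open>Each common digit multiplies the distance by beta, while all images stay in (0,
  1].\<close>

lemma bar_expansion_inject:
  assumes \<beta>: "\<beta> > 1" and xy: "0 < x" "x \<le> 1" "0 < y" "y \<le> 1"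
    and eq: "bar_expansion \<beta> x = bar_expansion \<beta> y"
  shows "x = y"
proof (rule ccontr)
  assume "x \<noteq> y"
  have bound: "\<bar>x - y\<bar> * \<beta> ^ n \<le> 1" for n
    using xy eq
  proof (induction n arbitrary: x y)
    case (Suc n)
    have e: "\<lceil>\<beta> * x\<rceil> = \<lceil>\<beta> * y\<rceil>" "bar_expansion \<beta> (bar_T \<beta> x) = bar_expansion \<beta> (bar_T \<beta> y)"
      using Suc.prems(5) bar_expansion_Cons[of \<beta> x] bar_expansion_Cons[of \<beta> y] by auto
    have "\<beta> * (x - y) = bar_T \<beta> x - bar_T \<beta> y"
      using mult_eq_digit_plus_bar_T[of \<beta> x] mult_eq_digit_plus_bar_T[of \<beta> y] e
      by (simp add: algebra_simps)
    then have "\<beta> * \<bar>x - y\<bar> = \<bar>bar_T \<beta> x - bar_T \<beta> y\<bar>"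
      using \<beta> by (metis abs_mult abs_of_pos less_trans zero_less_one)
    then have *: "\<bar>x - y\<bar> * \<beta> ^ Suc n = \<bar>bar_T \<beta> x - bar_T \<beta> y\<bar> * \<beta> ^ n"
      by (metis mult.commute mult.left_commute power_Suc)
    show ?case unfolding * by (rule Suc.IH[OF bar_T_pos bar_T_le_1 bar_T_pos bar_T_le_1 e(2)])
  qed auto
  obtain n where "1 / \<bar>x - y\<bar> < \<beta> ^ n" using real_arch_pow[OF \<beta>] by blast
  then have "1 < \<bar>x - y\<bar> * \<beta> ^ n" using \<open>x \<noteq> y\<close> by (simp add: field_simps)
  then show False using bound[of n] by simp
qed

section \<open>Values of digit words\<close>

lemma word_value_bounded:
  assumes \<beta>: "\<beta> > 1" and w: "\<And>n. 0 \<le> w !! n" "\<And>n. w !! n \<le> B"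
  shows "summable (\<lambda>n. of_int (w !! n) / \<beta> ^ (n + 1))"
    and "0 \<le> word_value \<beta> w" "word_value \<beta> w \<le> (\<Sum>n. of_int B / \<beta> ^ (n + 1))"
proof -
  have "summable (\<lambda>n. (1 / \<beta>) ^ n)" using \<beta> by (intro summable_geometric) simp
  then have "summable (\<lambda>n. of_int B / \<beta> * (1 / \<beta>) ^ n)" by (rule summable_mult)
  then have B: "summable (\<lambda>n. of_int B / \<beta> ^ (n + 1))" by (simp add: power_divide mult.commute)
  have le: "of_int (w !! n) / \<beta> ^ (n + 1) \<le> of_int B / \<beta> ^ (n + 1)" for n
    using w[of n] \<beta> by (intro divide_right_mono) auto
  have nonneg: "0 \<le> of_int (w !! n) / \<beta> ^ (n + 1)" for n
    using w[of n] \<beta> by auto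
  show sw: "summable (\<lambda>n. of_int (w !! n) / \<beta> ^ (n + 1))"
    by (rule summable_comparison_test'[OF B]) (simp only: real_norm_def abs_of_nonneg[OF nonneg] le)
  show "0 \<le> word_value \<beta> w" unfolding word_value_def by (rule suminf_nonneg[OF sw nonneg])
  show "word_value \<beta> w \<le> (\<Sum>n. of_int B / \<beta> ^ (n + 1))"
    unfolding word_value_def by (rule suminf_le[OF le sw B])
qed

lemma word_value_shift:
  assumes \<beta>: "\<beta> > 1" and w: "\<And>n. 0 \<le> w !! n" "\<And>n. w !! n \<le> B"
  shows "\<beta> * word_value \<beta> w = of_int (shd w) + word_value \<beta> (stl w)"
proof -
  have stl: "summable (\<lambda>n. of_int (stl w !! n) / \<beta> ^ (n + 1))"
    using word_value_bounded(1)[OF \<beta>, of "stl w" B] w(1)[of "Suc _"] w(2)[of "Suc _"] by simp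
  have "word_value \<beta> w = of_int (shd w) / \<beta> + (\<Sum>n. of_int (stl w !! n) / \<beta> ^ (Suc n + 1))"
    unfolding word_value_def using suminf_split_head[OF word_value_bounded(1)[OF \<beta> w]] by simp
  also have "(\<Sum>n. of_int (stl w !! n) / \<beta> ^ (Suc n + 1)) = (\<Sum>n. of_int (stl w !! n) / \<beta> ^ (n + 1) / \<beta>)"
    by (simp add: field_simps)
  also have "\<dots> = word_value \<beta> (stl w) / \<beta>"
    unfolding word_value_def by (rule suminf_divide[OF stl])
  finally show ?thesis using \<beta> by (simp add: field_simps)
qed

text \<open>At the first difference the digit of y is smaller by at least 1, which compensates for a
  remainder of at most 1.\<close>

lemma le_word_value:
  assumes \<beta>: "\<beta> > 1" and w: "\<And>n. 0 \<le> w !! n" "\<And>n. w !! n \<le> B"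
    and less: "bar_expansion \<beta> y <\<^sub>l\<^sub>e\<^sub>x w"
  shows "y \<le> word_value \<beta> w"
proof -
  have "y \<le> word_value \<beta> w" if "\<forall>i<k. bar_expansion \<beta> y !! i = w !! i" "bar_expansion \<beta> y !! k < w !! k" for k
    using that w
  proof (induction k arbitrary: y w)
    case 0
    have "0 \<le> word_value \<beta> (stl w)"
      using word_value_bounded(2)[OF \<beta>, of "stl w" B] 0(3)[of "Suc _"] 0(4)[of "Suc _"] by simp
    moreover have "real_of_int (\<lceil>\<beta> * y\<rceil> - 1) + 1 \<le> shd w"
      using 0(2) by (simp add: bar_expansion_def)
    ultimately have "\<beta> * y \<le> \<beta> * word_value \<beta> w"
      using word_value_shift[OF \<beta> 0(3,4)] mult_eq_digit_plus_bar_T[of \<beta> y] bar_T_le_1[of \<beta> y] by linarith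
    then show ?case using \<beta> by simp
  next
    case (Suc k)
    have "bar_T \<beta> y \<le> word_value \<beta> (stl w)"
    proof (rule Suc.IH)
      show "\<forall>i<k. bar_expansion \<beta> (bar_T \<beta> y) !! i = stl w !! i"
      proof (intro allI impI)
        fix i assume "i < k"
        then show "bar_expansion \<beta> (bar_T \<beta> y) !! i = stl w !! i"
          using Suc.prems(1)[rule_format, of "Suc i"] bar_expansion_Cons[of \<beta> y]
          by (metis Suc_mono snth_Stream snth.simps(2))
      qed
      show "bar_expansion \<beta> (bar_T \<beta> y) !! k < stl w !! k"
        using Suc.prems(2) bar_expansion_Cons[of \<beta> y] by (metis snth_Stream snth.simps(2))
    qed (use Suc.prems(3)[of "Suc _"] Suc.prems(4)[of "Suc _"] in simp_all)
    moreover have "\<lceil>\<beta> * y\<rceil> - 1 = shd w"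
      using Suc.prems(1)[rule_format, of 0] by (simp add: bar_expansion_def)
    ultimately have "\<beta> * y \<le> \<beta> * word_value \<beta> w"
      using word_value_shift[OF \<beta> Suc.prems(3,4)] mult_eq_digit_plus_bar_T[of \<beta> y] by simp
    then show ?case using \<beta> by simp
  qed
  then show ?thesis using less unfolding word_less_def by blast
qed

text \<open>A first attempt at the upper bound: a tail of w is not yet known to have value at most
  1. If all tails exceed 1 by at most E, the division by beta leaves an error of only E /
  beta.\<close>

lemma word_value_le_aux:
  assumes \<beta>: "\<beta> > 1" and w: "\<And>n. 0 \<le> w !! n" "\<And>n. w !! n \<le> B"
    and E: "\<And>n. word_value \<beta> (sdrop n w) \<le> 1 + E" "0 \<le> E"
    and less: "w <\<^sub>l\<^sub>e\<^sub>x bar_expansion \<beta> y"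
  shows "word_value \<beta> w \<le> y + E / \<beta>"
proof -
  have "word_value \<beta> w \<le> y + E / \<beta>"
    if "\<forall>i<k. w !! i = bar_expansion \<beta> y !! i" "w !! k < bar_expansion \<beta> y !! k" for k
    using that w E(1)
  proof (induction k arbitrary: y w)
    case 0
    have "word_value \<beta> (stl w) \<le> 1 + E" using 0(5)[of 1] by simp
    moreover have "real_of_int (shd w) + 1 \<le> real_of_int (\<lceil>\<beta> * y\<rceil> - 1)"
      using 0(2) by (simp add: bar_expansion_def)
    ultimately have "\<beta> * word_value \<beta> w \<le> \<beta> * y + E"
      using word_value_shift[OF \<beta> 0(3,4)] mult_eq_digit_plus_bar_T[of \<beta> y] bar_T_pos[of \<beta> y] by linarith
    then show ?case using \<beta> by (simp add: field_simps)
  next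
    case (Suc k)
    have "word_value \<beta> (stl w) \<le> bar_T \<beta> y + E / \<beta>"
    proof (rule Suc.IH)
      show "\<forall>i<k. stl w !! i = bar_expansion \<beta> (bar_T \<beta> y) !! i"
      proof (intro allI impI)
        fix i assume "i < k"
        then show "stl w !! i = bar_expansion \<beta> (bar_T \<beta> y) !! i"
          using Suc.prems(1)[rule_format, of "Suc i"] bar_expansion_Cons[of \<beta> y]
          by (metis Suc_mono snth_Stream snth.simps(2))
      qed
      show "stl w !! k < bar_expansion \<beta> (bar_T \<beta> y) !! k"
        using Suc.prems(2) bar_expansion_Cons[of \<beta> y] by (metis snth_Stream snth.simps(2))
    qed (use Suc.prems(3)[of "Suc _"] Suc.prems(4)[of "Suc _"] Suc.prems(5)[of "Suc _"] in simp_all)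
    moreover have "shd w = \<lceil>\<beta> * y\<rceil> - 1"
      using Suc.prems(1)[rule_format, of 0] by (simp add: bar_expansion_def)
    ultimately have "\<beta> * word_value \<beta> w \<le> \<beta> * y + E / \<beta>"
      using word_value_shift[OF \<beta> Suc.prems(3,4)] mult_eq_digit_plus_bar_T[of \<beta> y] by simp
    then have "word_value \<beta> w \<le> y + E / \<beta> / \<beta>" using \<beta> by (simp add: field_simps)
    also have "E / \<beta> \<le> E" using \<beta> E(2) by (simp add: field_simps mult_le_cancel_left1)
    then have "E / \<beta> / \<beta> \<le> E / \<beta>" using \<beta> by (intro divide_right_mono) auto
    finally show ?case by simp
  qed
  then show ?thesis using less unfolding word_less_def by blast
qed

text \<open>Apply the previous estimate to the supremum M of the values of all shifts. If M > 1, the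
  choice E = M - 1 gives M <= y + (M - 1) / beta < M, which is absurd; then E = 0 gives the
  claim.\<close>

lemma word_value_le:
  assumes \<beta>: "\<beta> > 1" and w: "\<And>n. 0 \<le> w !! n" "\<And>n. w !! n \<le> B" and y: "y \<le> 1"
    and less: "\<And>n. sdrop n w <\<^sub>l\<^sub>e\<^sub>x bar_expansion \<beta> y"
  shows "word_value \<beta> (sdrop n w) \<le> y"
proof -
  define M where "M = (SUP n. word_value \<beta> (sdrop n w))"
  have sw: "\<And>m. 0 \<le> sdrop n w !! m" "\<And>m. sdrop n w !! m \<le> B" for n
    using w by (simp_all add: sdrop_snth)
  \<comment> \<open>The bound of \<open>word_value_bounded\<close> depends only on the largest
    letter and is therefore common to all shifts.\<close>
  have bdd: "bdd_above (range (\<lambda>n. word_value \<beta> (sdrop n w)))"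
    by (rule bdd_aboveI2[OF word_value_bounded(3)[OF \<beta> sw]])
  have M: "word_value \<beta> (sdrop n w) \<le> M" for n
    unfolding M_def by (rule cSUP_upper[OF _ bdd]) simp
  have step: "word_value \<beta> (sdrop n w) \<le> y + E / \<beta>" if "M \<le> 1 + E" "0 \<le> E" for n E
  proof (rule word_value_le_aux[OF \<beta> sw])
    show "word_value \<beta> (sdrop m (sdrop n w)) \<le> 1 + E" for m
      using M[of "n + m"] that by simp
  qed (use that less in auto)
  have "M \<le> 1"
  proof (rule ccontr)
    assume *: "\<not> M \<le> 1"
    then have "M \<le> y + (M - 1) / \<beta>"
      unfolding M_def using step[of "M - 1"] unfolding M_def by (intro cSUP_least) auto
    also have "\<dots> < 1 + (M - 1)" using y * \<beta> by (intro add_le_less_mono) (auto simp: divide_less_eq mult_less_cancel_left1)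
    finally show False by simp
  qed
  then show ?thesis using step[of 0 n] by simp
qed

lemma bar_expansion_word_value:
  assumes \<beta>: "\<beta> > 1" and w: "\<And>n. 0 \<le> w !! n" "\<And>n. w !! n \<le> B" and t: "0 < t" "t' \<le> 1"
    and lo: "\<And>n. bar_expansion \<beta> t <\<^sub>l\<^sub>e\<^sub>x sdrop n w" and hi: "\<And>n. sdrop n w <\<^sub>l\<^sub>e\<^sub>x bar_expansion \<beta> t'"
  shows "word_value \<beta> (sdrop n w) \<in> {t..t'}"
    and "(bar_T \<beta> ^^ n) (word_value \<beta> w) = word_value \<beta> (sdrop n w)"
    and "bar_expansion \<beta> (word_value \<beta> w) = w"
proof -
  have sw: "\<And>m. 0 \<le> sdrop n w !! m" "\<And>m. sdrop n w !! m \<le> B" for n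
    using w by (simp_all add: sdrop_snth)
  have in_tt: "word_value \<beta> (sdrop n w) \<in> {t..t'}" for n
    using le_word_value[OF \<beta> sw lo] word_value_le[OF \<beta> w t(2) hi] by auto
  then show "word_value \<beta> (sdrop n w) \<in> {t..t'}" .
  have step: "\<lceil>\<beta> * word_value \<beta> (sdrop n w)\<rceil> - 1 = w !! n"
    "bar_T \<beta> (word_value \<beta> (sdrop n w)) = word_value \<beta> (sdrop (Suc n) w)" for n
  proof -
    have e: "\<beta> * word_value \<beta> (sdrop n w) = of_int (w !! n) + word_value \<beta> (sdrop (Suc n) w)"
      using word_value_shift[OF \<beta> sw[of n]] by simp
    \<comment> \<open>The ceiling minus one recovers the digit exactly when the remainder lies in
      (0, 1]; this is where the positivity of t enters.\<close>
    have "0 < word_value \<beta> (sdrop (Suc n) w)" "word_value \<beta> (sdrop (Suc n) w) \<le> 1"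
      using in_tt[of "Suc n"] t by auto
    then have "\<lceil>\<beta> * word_value \<beta> (sdrop n w)\<rceil> = w !! n + 1"
      unfolding e by (intro ceiling_unique) auto
    then show "\<lceil>\<beta> * word_value \<beta> (sdrop n w)\<rceil> - 1 = w !! n"
      "bar_T \<beta> (word_value \<beta> (sdrop n w)) = word_value \<beta> (sdrop (Suc n) w)"
      using mult_eq_digit_plus_bar_T[of \<beta> "word_value \<beta> (sdrop n w)"] e by simp_all
  qed
  have iter: "(bar_T \<beta> ^^ n) (word_value \<beta> w) = word_value \<beta> (sdrop n w)" for n
    by (induction n) (simp_all add: step(2) del: sdrop.simps(2))
  then show "(bar_T \<beta> ^^ n) (word_value \<beta> w) = word_value \<beta> (sdrop n w)" .
  show "bar_expansion \<beta> (word_value \<beta> w) = w"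
    by (rule stream_eqI) (simp add: bar_expansion_def iter step(1))
qed

text \<open>The sum of n consecutive letters differs from alpha n by less than 1, so the average is
  within 1/n of alpha.\<close>

lemma has_frequency_upper_mech:
  assumes "bar_expansion \<beta> x = sdrop j (upper_mech \<alpha>)"
  shows "has_frequency \<beta> x \<alpha>"
  unfolding has_frequency_def
proof (rule LIMSEQ_I)
  fix r :: real assume "r > 0"
  obtain M :: nat where M: "M > 1 / r" using reals_Archimedean2 by blast
  show "\<exists>M. \<forall>n\<ge>M. norm ((\<Sum>k<n. of_int (bar_expansion \<beta> x !! k)) / real n - \<alpha>) < r"
  proof (intro exI allI impI)
    fix n assume "n \<ge> M"
    then have n: "1 / r < real n" using M by linarith
    then have "n > 0" using \<open>r > 0\<close> by (metis divide_pos_pos less_trans of_nat_0_less_iff zero_less_one)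
    have "(\<Sum>k<n. real_of_int (bar_expansion \<beta> x !! k)) = \<lceil>\<alpha> * j + \<alpha> * n\<rceil> - \<lceil>\<alpha> * j\<rceil>"
      using psum_sdrop_upper_mech[of j \<alpha> n] unfolding assms psum_eq_sum
      by (simp only: of_int_sum[symmetric] of_int_diff[symmetric])
    moreover have "\<bar>real_of_int \<lceil>\<alpha> * j + \<alpha> * n\<rceil> - \<lceil>\<alpha> * j\<rceil> - \<alpha> * n\<bar> < 1" by linarith
    ultimately have "\<bar>(\<Sum>k<n. real_of_int (bar_expansion \<beta> x !! k)) - \<alpha> * n\<bar> < 1" by simp
    then have "\<bar>(\<Sum>k<n. real_of_int (bar_expansion \<beta> x !! k)) - \<alpha> * n\<bar> / n < 1 / n"
      using \<open>n > 0\<close> by (simp add: divide_strict_right_mono)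
    also have "\<dots> < r" using n \<open>n > 0\<close> \<open>r > 0\<close> by (simp add: field_simps)
    also have "\<bar>(\<Sum>k<n. real_of_int (bar_expansion \<beta> x !! k)) - \<alpha> * n\<bar> / n =
      norm ((\<Sum>k<n. real_of_int (bar_expansion \<beta> x !! k)) / real n - \<alpha>)"
    proof -
      have "X / real n - \<alpha> = (X - \<alpha> * n) / n" for X using \<open>n > 0\<close> by (simp add: field_simps)
      then show ?thesis by simp
    qed
    finally show "norm ((\<Sum>k<n. of_int (bar_expansion \<beta> x !! k)) / real n - \<alpha>) < r" .
  qed
qed

section \<open>The orbit closure attached to a gap\<close>

lemma bar_expansion_add_inverse:
  assumes "\<beta> > 1" "bar_expansion \<beta> t = a ## s"
  shows "bar_expansion \<beta> (t + 1 / \<beta>) = (a + 1) ## s"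
proof -
  have e: "\<beta> * (t + 1 / \<beta>) = \<beta> * t + 1" using assms(1) by (simp add: field_simps)
  have "bar_T \<beta> (t + 1 / \<beta>) = bar_T \<beta> t" unfolding bar_T_def angle_frac_eq e by simp
  then show ?thesis
    using assms(2) bar_expansion_Cons[of \<beta> t] bar_expansion_Cons[of \<beta> "t + 1 / \<beta>"] e by simp
qed

text \<open>Existence: all shifts of (bza)^omega lie strictly between as and bs, so their values
  form a periodic orbit inside I. Uniqueness: an orbit in I has a trapped expansion with the same
  shifts as (bza)^omega, and expansions determine points of (0, 1].\<close>

lemma gap_orbit_closure:
  assumes \<beta>: "\<beta> > 1" and t: "0 < t" "t \<le> 1 - 1 / \<beta>"
    and exp: "bar_expansion \<beta> t = a ## s" and a: "0 \<le> a" and ab: "b = a + 1"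
    and I: "I = {t..t + 1 / \<beta>}" and z: "central a b z"
    and gap: "cycle (z @ [a, b]) <\<^sub>l\<^sub>e\<^sub>x s" "s <\<^sub>l\<^sub>e\<^sub>x cycle (z @ [b, a])"
  shows "contains_orbit_closure_of \<beta> I (b # z @ [a])
           (real_of_int (sum_list (a # z @ [b])) / real (length z + 2))"
    and "\<exists>!S. is_orbit_closure \<beta> S \<and> invariant \<beta> S \<and> S \<subseteq> I"
proof -
  define L U where "L = cycle (a # z @ [b])" and "U = cycle (b # z @ [a])"
  define \<alpha> where "\<alpha> = real_of_int (sum_list (a # z @ [b])) / real (length z + 2)"
  define N where "N = length z + 2"
  have chr: "christoffel (a # z @ [b])" by (rule central_christoffel[OF z ab])
  have exp': "bar_expansion \<beta> (t + 1 / \<beta>) = b ## s"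
    using bar_expansion_add_inverse[OF \<beta> exp] ab by simp
  \<comment> \<open>Prefixing a to s < (zba)^omega gives as < (azb)^omega; prefixing b to the other
    inequality gives (bza)^omega < bs.\<close>
  have aL: "a ## s <\<^sub>l\<^sub>e\<^sub>x L" and Ub: "U <\<^sub>l\<^sub>e\<^sub>x b ## s"
    using gap by (simp_all add: L_def U_def cycle_Christoffel_unfold(1))
  have btw: "L \<le>\<^sub>l\<^sub>e\<^sub>x sdrop n U" "sdrop n U \<le>\<^sub>l\<^sub>e\<^sub>x U" for n
    using christoffel_shifts_between[OF chr ab] by (simp_all add: L_def U_def)
  have "U !! n \<in> {a, b}" for n
    using z snth_sset[of U n] by (auto simp: U_def central_def)
  then have letters: "0 \<le> U !! n" "U !! n \<le> b" for n
    using a ab by (metis empty_iff insert_iff add_increasing2 zero_le_one,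
        metis empty_iff insert_iff order_refl less_imp_le zless_add1_eq)
  have t': "t + 1 / \<beta> \<le> 1" using t by simp
  note B = bar_expansion_word_value[OF \<beta> letters t(1) t', unfolded exp exp',
      OF word_less_le_trans[OF aL btw(1)] word_le_less_trans[OF btw(2) Ub]]
  define x where "x = word_value \<beta> U"
  have orb: "(bar_T \<beta> ^^ n) x = word_value \<beta> (sdrop n U)" for n using B(2) by (simp add: x_def)
  have orbI: "(bar_T \<beta> ^^ n) x \<in> I" for n using B(1)[of n] orb I by simp
  have expx: "bar_expansion \<beta> ((bar_T \<beta> ^^ n) x) = sdrop n U" for n
    using B(3) sdrop_bar_expansion[of n \<beta> x] by (simp add: x_def)
  have I01: "0 < y \<and> y \<le> 1" if "y \<in> I" for y using that I t by auto
  have per: "sdrop N U = U"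
    using sdrop_cycle_eq[of "b # z @ [a]"] by (simp add: U_def N_def)
  \<comment> \<open>The orbit is finite, so taking its closure adds nothing.\<close>
  have "range (\<lambda>n. (bar_T \<beta> ^^ n) x) \<subseteq> (\<lambda>n. (bar_T \<beta> ^^ n) x) ` {..<N}"
  proof safe
    fix n
    have "sdrop n U = sdrop (n mod N) U"
      using sdrop_add[of "n mod N" "n div N * N" U] sdrop_mult_period[OF per, of "n div N"] by simp
    then show "(bar_T \<beta> ^^ n) x \<in> (\<lambda>n. (bar_T \<beta> ^^ n) x) ` {..<N}"
      using orb by (intro image_eqI[of _ _ "n mod N"]) (auto simp: N_def)
  qed
  then have "finite (range (\<lambda>n. (bar_T \<beta> ^^ n) x))" by (rule finite_subset) simp
  then have oc: "orbit_closure \<beta> x = range (\<lambda>n. (bar_T \<beta> ^^ n) x)"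
    unfolding orbit_closure_def by (intro closure_closed finite_imp_closed)
  have ioc: "is_orbit_closure \<beta> (orbit_closure \<beta> x)"
    unfolding is_orbit_closure_def using I01[OF orbI[of 0]] by (intro bexI[of _ x]) auto
  have sub: "orbit_closure \<beta> x \<subseteq> I" unfolding oc using orbI by auto
  have inv: "invariant \<beta> (orbit_closure \<beta> x)"
    unfolding invariant_def oc
  proof (intro equalityI subsetI)
    fix y assume "y \<in> bar_T \<beta> ` range (\<lambda>n. (bar_T \<beta> ^^ n) x)"
    then obtain n where "y = (bar_T \<beta> ^^ Suc n) x" by auto
    then show "y \<in> range (\<lambda>n. (bar_T \<beta> ^^ n) x)" by blast
  next
    fix y assume "y \<in> range (\<lambda>n. (bar_T \<beta> ^^ n) x)"
    then obtain n where y: "y = (bar_T \<beta> ^^ n) x" by auto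
    \<comment> \<open>Going once round the period writes every point of the orbit as an image,
      including the first one.\<close>
    also have "\<dots> = (bar_T \<beta> ^^ (N + n)) x" using orb[of n] orb[of "N + n"] per sdrop_add[of n N U] by simp
    also have "\<dots> = bar_T \<beta> ((bar_T \<beta> ^^ (Suc (length z) + n)) x)" by (simp add: N_def)
    finally show "y \<in> bar_T \<beta> ` range (\<lambda>n. (bar_T \<beta> ^^ n) x)" by blast
  qed
  have "set_has_frequency \<beta> (orbit_closure \<beta> x) \<alpha>"
    unfolding set_has_frequency_def oc
    using has_frequency_upper_mech[of \<beta> _ _ \<alpha>] expx christoffel_cycle_upper[OF chr ab]
    unfolding U_def \<alpha>_def by auto
  then show "contains_orbit_closure_of \<beta> I (b # z @ [a])
           (real_of_int (sum_list (a # z @ [b])) / real (length z + 2))"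
    using ioc sub inv by (simp add: contains_orbit_closure_of_def Let_def x_def U_def \<alpha>_def)
  show "\<exists>!S. is_orbit_closure \<beta> S \<and> invariant \<beta> S \<and> S \<subseteq> I"
  proof (intro ex1I conjI)
    fix S assume S: "is_orbit_closure \<beta> S \<and> invariant \<beta> S \<and> S \<subseteq> I"
    then obtain y where y: "S = orbit_closure \<beta> y" by (auto simp: is_orbit_closure_def)
    have yI: "(bar_T \<beta> ^^ n) y \<in> I" for n
      using S y closure_subset[of "range (\<lambda>n. (bar_T \<beta> ^^ n) y)"] by (auto simp: orbit_closure_def)
    define w where "w = bar_expansion \<beta> y"
    have w: "sdrop n w = bar_expansion \<beta> ((bar_T \<beta> ^^ n) y)" for n
      by (simp add: w_def sdrop_bar_expansion)
    have "a ## s \<le>\<^sub>l\<^sub>e\<^sub>x sdrop n w" "sdrop n w \<le>\<^sub>l\<^sub>e\<^sub>x b ## s" for n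
      unfolding w exp[symmetric] exp'[symmetric] using yI[of n] I by (auto intro!: bar_expansion_mono[OF \<beta>])
    from gap_trapped[OF ab gap this]
    have rng: "range (\<lambda>n. sdrop n w) = range (\<lambda>n. sdrop n U)"
      unfolding U_def by (intro christoffel_trapped_range[OF chr ab]) blast+
    have inj: "(bar_T \<beta> ^^ n) y = (bar_T \<beta> ^^ m) x" if "sdrop n w = sdrop m U" for n m
      using bar_expansion_inject[OF \<beta>] I01 yI orbI expx w that by metis
    have "range (\<lambda>n. (bar_T \<beta> ^^ n) y) = range (\<lambda>n. (bar_T \<beta> ^^ n) x)"
    proof (intro equalityI subsetI)
      fix v assume "v \<in> range (\<lambda>n. (bar_T \<beta> ^^ n) y)"
      then obtain n where n: "v = (bar_T \<beta> ^^ n) y" by auto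
      have "sdrop n w \<in> range (\<lambda>n. sdrop n U)" unfolding rng[symmetric] by blast
      then obtain m where "sdrop n w = sdrop m U" by blast
      then show "v \<in> range (\<lambda>n. (bar_T \<beta> ^^ n) x)" using inj n by auto
    next
      fix v assume "v \<in> range (\<lambda>n. (bar_T \<beta> ^^ n) x)"
      then obtain m where m: "v = (bar_T \<beta> ^^ m) x" by auto
      have "sdrop m U \<in> range (\<lambda>n. sdrop n w)" unfolding rng by blast
      then obtain n where "sdrop n w = sdrop m U" by force
      then show "v \<in> range (\<lambda>n. (bar_T \<beta> ^^ n) y)" using inj m by (metis rangeI)
    qed
    then show "S = orbit_closure \<beta> x" unfolding y orbit_closure_def by simp
  qed (fact ioc inv sub)+
qed

section \<open>The longest central prefix\<close>

lemma central_replicate: "c \<in> {a, b} \<Longrightarrow> central a b (replicate k c)"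
  unfolding central_def letter_power_def by auto

lemma centralI:
  assumes "palindrome w" "palindrome x" "palindrome y" "w = x @ [a, b] @ y" "set w \<subseteq> {a, b}"
  shows "central a b w"
  using assms unfolding central_def by blast

lemma longest_central_prefix_bound:
  assumes "longest_central_prefix a b s u" "central a b w" "s = w @- x"
  shows "length w \<le> length u"
  using assms by (auto simp: longest_central_prefix_def stake_shift)

text \<open>Excluding mechanical words bounds the lengths of central prefixes, and the empty prefix
  is central, so a maximum is attained. A prefix is determined by its length.\<close>

lemma longest_central_prefix_exists:
  assumes "b = a + 1"
    and "\<not> (\<exists>\<alpha>\<in>{real_of_int a..real_of_int b}. a ## s = lower_mech \<alpha> \<or> b ## s = upper_mech \<alpha>)"
  shows "\<exists>!u. longest_central_prefix a b s u"
proof -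
  let ?P = "\<lambda>u. central a b u \<and> stake (length u) s = u"
  have "\<exists>K. \<forall>u. ?P u \<longrightarrow> \<not> K \<le> length u"
  proof (rule ccontr)
    assume "\<not> ?thesis"
    then have "\<exists>u. central a b u \<and> stake (length u) s = u \<and> K \<le> length u" for K by blast
    from arbitrarily_long_central_prefixes[OF assms(1) this] assms(2) show False by blast
  qed
  then obtain K where K: "\<forall>u. ?P u \<longrightarrow> length u < K" by (meson not_le)
  have "?P []" using central_replicate[of a a b 0] by simp
  then have "\<exists>u. ?P u \<and> (\<forall>w. ?P w \<longrightarrow> length w \<le> length u)"
    by (rule ex_has_greatest_nat[of ?P "[]" length K]) (rule K)
  then obtain u where "?P u" "\<forall>w. ?P w \<longrightarrow> length w \<le> length u" by blast
  then have u: "longest_central_prefix a b s u" by (simp add: longest_central_prefix_def)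
  moreover have "w = u" if "longest_central_prefix a b s w" for w
    using that u unfolding longest_central_prefix_def by (metis le_antisym)
  ultimately show ?thesis by blast
qed

section \<open>Gaps containing a given word\<close>

text \<open>Equivalently, as < (azb)^omega and (bza)^omega < bs: prefixing b to the lower end or a
  to the upper end gives these periodic words.\<close>

definition gap :: "int \<Rightarrow> int \<Rightarrow> int stream \<Rightarrow> int list \<Rightarrow> bool" where
  "gap a b s z \<longleftrightarrow> cycle (z @ [a, b]) <\<^sub>l\<^sub>e\<^sub>x s \<and> s <\<^sub>l\<^sub>e\<^sub>x cycle (z @ [b, a])"

text \<open>Maximality keeps v from starting with a and from being ba^k, since a^(k+1) and a^k b a^k
  are central. The word ba^k separates the two gaps because (ba^k)^omega occurs in the lower end of
  the gap of a^(k-1), and (a^(k+1) b)^omega, which starts with a^k, in the upper end of the gap of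
  a^k.\<close>

lemma longest_lower_power_gap:
  assumes ab: "b = a + 1" and u: "longest_central_prefix a b s (replicate k a)" and k: "k \<ge> 1"
    and s: "s = replicate k a @- v @- s'" and v: "length v = k + 1"
  shows "pad v <\<^sub>l\<^sub>e\<^sub>x pad (replicate (k + 1) a) \<Longrightarrow> s <\<^sub>l\<^sub>e\<^sub>x sconst a"
    and "pad (replicate (k + 1) a) <\<^sub>l\<^sub>e\<^sub>x pad v \<Longrightarrow> pad v <\<^sub>l\<^sub>e\<^sub>x pad (b # replicate k a) \<Longrightarrow>
      gap a b s (replicate k a)"
    and "pad (b # replicate k a) <\<^sub>l\<^sub>e\<^sub>x pad v \<Longrightarrow> gap a b s (replicate (k - 1) a)"
    and "v \<noteq> replicate (k + 1) a" "v \<noteq> b # replicate k a"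
proof -
  obtain c v' where c: "v = c # v'" "length v' = k" using v by (cases v) auto
  have "c \<noteq> a"
  proof
    assume "c = a"
    then have "s = replicate (Suc k) a @- v' @- s'"
      using s c by (metis replicate_Suc replicate_append_same shift.simps shift_append)
    from longest_central_prefix_bound[OF u central_replicate this] show False by simp
  qed
  show "v \<noteq> replicate (k + 1) a" using c \<open>c \<noteq> a\<close> by simp
  show "v \<noteq> b # replicate k a"
  proof
    assume "v = b # replicate k a"
    then have "s = (replicate k a @ b # replicate k a) @- s'" using s by simp
    moreover have "central a b (replicate k a @ b # replicate k a)"
    proof (rule centralI)
      \<comment> \<open>The letter a of the factor ab is taken from the left block, which is
        possible because k is at least 1.\<close>
      show "replicate k a @ b # replicate k a = replicate (k - 1) a @ [a, b] @ replicate k a"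
        using k by (cases k) (simp_all add: replicate_app_Cons_same)
    qed (auto simp: palindrome_def)
    ultimately show False using longest_central_prefix_bound[OF u] by fastforce
  qed
  show "s <\<^sub>l\<^sub>e\<^sub>x sconst a" if "pad v <\<^sub>l\<^sub>e\<^sub>x pad (replicate (k + 1) a)"
  proof -
    have "v @- s' <\<^sub>l\<^sub>e\<^sub>x replicate (k + 1) a @- sconst a"
      using that v by (intro pad_less_imp_shift_less) auto
    then have "v @- s' <\<^sub>l\<^sub>e\<^sub>x sconst a" by (simp only: shift_replicate_sconst)
    then have "s <\<^sub>l\<^sub>e\<^sub>x replicate k a @- sconst a" unfolding s by (simp only: word_less_shift)
    then show ?thesis by (simp only: shift_replicate_sconst)
  qed
  show "gap a b s (replicate k a)"
    if *: "pad (replicate (k + 1) a) <\<^sub>l\<^sub>e\<^sub>x pad v" "pad v <\<^sub>l\<^sub>e\<^sub>x pad (b # replicate k a)"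
  proof -
    have cb: "c = b" "pad v' <\<^sub>l\<^sub>e\<^sub>x pad (replicate k a)" using * c \<open>c \<noteq> a\<close> ab by auto
    let ?L = "cycle (a # replicate k a @ [b])"
    have "?L = (a # replicate k a @ [b]) @- ?L" by (rule cycle_decomp) simp
    moreover have "(a # replicate k a @ [b]) @- ?L = (replicate k a @ [a, b]) @- ?L"
      by (simp add: replicate_app_Cons_same del: shift_append)
    ultimately have L: "?L = replicate k a @- [a, b] @- ?L" unfolding shift_append by (rule trans)
    have "v' @- s' <\<^sub>l\<^sub>e\<^sub>x replicate k a @- [a, b] @- ?L"
      using cb c by (intro pad_less_imp_shift_less) auto
    also note L[symmetric]
    finally show ?thesis
      using cb c ab by (simp add: gap_def cycle_Christoffel_unfold(2) s)
  qed
  show "gap a b s (replicate (k - 1) a)" if *: "pad (b # replicate k a) <\<^sub>l\<^sub>e\<^sub>x pad v"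
  proof -
    obtain m where m: "k = Suc m" using k by (cases k) auto
    let ?U = "cycle (b # replicate m a @ [a])"
    have "(b # replicate k a) @- ?U <\<^sub>l\<^sub>e\<^sub>x v @- s'"
      using * v by (intro pad_less_imp_shift_less) auto
    moreover have "?U = (b # replicate k a) @- ?U"
      using cycle_decomp[of "b # replicate m a @ [a]"] m by (simp add: replicate_append_same)
    ultimately have "?U <\<^sub>l\<^sub>e\<^sub>x v @- s'" by simp
    moreover have "s = replicate m a @- a ## v @- s'"
      using s m by (metis replicate_Suc replicate_append_same shift.simps shift_append)
    ultimately show ?thesis using m ab by (simp add: gap_def cycle_Christoffel_unfold(2))
  qed
qed

text \<open>The previous argument with the letters exchanged and the order reversed.\<close>

lemma longest_upper_power_gap:
  assumes ab: "b = a + 1" and u: "longest_central_prefix a b s (replicate k b)" and k: "k \<ge> 1"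
    and s: "s = replicate k b @- v @- s'" and v: "length v = k + 1"
  shows "pad (replicate (k + 1) b) <\<^sub>l\<^sub>e\<^sub>x pad v \<Longrightarrow> sconst b <\<^sub>l\<^sub>e\<^sub>x s"
    and "pad (a # replicate k b) <\<^sub>l\<^sub>e\<^sub>x pad v \<Longrightarrow> pad v <\<^sub>l\<^sub>e\<^sub>x pad (replicate (k + 1) b) \<Longrightarrow>
      gap a b s (replicate k b)"
    and "pad v <\<^sub>l\<^sub>e\<^sub>x pad (a # replicate k b) \<Longrightarrow> gap a b s (replicate (k - 1) b)"
    and "v \<noteq> replicate (k + 1) b" "v \<noteq> a # replicate k b"
proof -
  obtain c v' where c: "v = c # v'" "length v' = k" using v by (cases v) auto
  have "c \<noteq> b"
  proof
    assume "c = b"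
    then have "s = replicate (Suc k) b @- v' @- s'"
      using s c by (metis replicate_Suc replicate_append_same shift.simps shift_append)
    from longest_central_prefix_bound[OF u central_replicate this] show False by simp
  qed
  show "v \<noteq> replicate (k + 1) b" using c \<open>c \<noteq> b\<close> by simp
  show "v \<noteq> a # replicate k b"
  proof
    assume "v = a # replicate k b"
    then have "s = (replicate k b @ a # replicate k b) @- s'" using s by simp
    moreover have "central a b (replicate k b @ a # replicate k b)"
    proof (rule centralI)
      show "replicate k b @ a # replicate k b = replicate k b @ [a, b] @ replicate (k - 1) b"
        using k by (cases k) simp_all
    qed (auto simp: palindrome_def)
    ultimately show False using longest_central_prefix_bound[OF u] by fastforce
  qed
  show "sconst b <\<^sub>l\<^sub>e\<^sub>x s" if "pad (replicate (k + 1) b) <\<^sub>l\<^sub>e\<^sub>x pad v"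
  proof -
    have "replicate (k + 1) b @- sconst b <\<^sub>l\<^sub>e\<^sub>x v @- s'"
      using that v by (intro pad_less_imp_shift_less) auto
    then have "sconst b <\<^sub>l\<^sub>e\<^sub>x v @- s'" by (simp only: shift_replicate_sconst)
    then have "replicate k b @- sconst b <\<^sub>l\<^sub>e\<^sub>x s" unfolding s by (simp only: word_less_shift)
    then show ?thesis by (simp only: shift_replicate_sconst)
  qed
  show "gap a b s (replicate k b)"
    if *: "pad (a # replicate k b) <\<^sub>l\<^sub>e\<^sub>x pad v" "pad v <\<^sub>l\<^sub>e\<^sub>x pad (replicate (k + 1) b)"
  proof -
    have cb: "c = a" "pad (replicate k b) <\<^sub>l\<^sub>e\<^sub>x pad v'" using * c \<open>c \<noteq> b\<close> ab by auto
    let ?U = "cycle (b # replicate k b @ [a])"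
    have "?U = (b # replicate k b @ [a]) @- ?U" by (rule cycle_decomp) simp
    moreover have "(b # replicate k b @ [a]) @- ?U = (replicate k b @ [b, a]) @- ?U"
      by (simp add: replicate_app_Cons_same del: shift_append)
    ultimately have U: "?U = replicate k b @- [b, a] @- ?U" unfolding shift_append by (rule trans)
    note U
    also have "replicate k b @- [b, a] @- ?U <\<^sub>l\<^sub>e\<^sub>x v' @- s'"
      using cb c by (intro pad_less_imp_shift_less) auto
    finally show ?thesis
      using cb c ab by (simp add: gap_def cycle_Christoffel_unfold(2) s)
  qed
  show "gap a b s (replicate (k - 1) b)" if *: "pad v <\<^sub>l\<^sub>e\<^sub>x pad (a # replicate k b)"
  proof -
    obtain m where m: "k = Suc m" using k by (cases k) auto
    let ?L = "cycle (a # replicate m b @ [b])"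
    have "v @- s' <\<^sub>l\<^sub>e\<^sub>x (a # replicate k b) @- ?L"
      using * v by (intro pad_less_imp_shift_less) auto
    moreover have "?L = (a # replicate k b) @- ?L"
      using cycle_decomp[of "a # replicate m b @ [b]"] m by (simp add: replicate_append_same)
    ultimately have "v @- s' <\<^sub>l\<^sub>e\<^sub>x ?L" by simp
    moreover have "s = replicate m b @- b ## v @- s'"
      using s m by (metis replicate_Suc replicate_append_same shift.simps shift_append)
    ultimately show ?thesis using m ab by (simp add: gap_def cycle_Christoffel_unfold(2))
  qed
qed

section \<open>Gaps from a central word that is not a letter power\<close>

lemma cycle_unique:
  assumes "w \<noteq> []" "x = w @- x"
  shows "x = cycle w"
proof (rule stream_eqI)
  fix n
  show "x !! n = cycle w !! n"
  proof (induction n rule: less_induct)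
    case (less n)
    have e: "x !! n = (w @- x) !! n" "cycle w !! n = (w @- cycle w) !! n"
      using assms cycle_decomp[OF assms(1)] by simp_all
    show ?case
    proof (cases "n < length w")
      case False
      moreover have "0 < length w" using assms(1) by simp
      ultimately have "n - length w < n" by linarith
      then have "x !! (n - length w) = cycle w !! (n - length w)" by (rule less)
      then show ?thesis using e False by (simp add: shift_snth)
    qed (use e in \<open>simp add: shift_snth\<close>)
  qed
qed

text \<open>By the two factorizations of u, the right-hand side is unchanged when q dc is prepended,
  so it is the periodic word. One end of the gap of q thus appears as u, two letters and the other
  end; exchanging the letters gives the same for p.\<close>

lemma cycle_central_unfold:
  assumes "u = q @ [d, c] @ p" "u = p @ [c, d] @ q"
  shows "cycle (q @ [d, c]) = u @- c ## d ## cycle (q @ [c, d])"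
proof -
  let ?Z = "cycle (q @ [c, d])"
  have Z: "?Z = q @- c ## d ## ?Z" using cycle_decomp[of "q @ [c, d]"] by simp
  have "u @- c ## d ## ?Z = q @- d ## c ## p @- c ## d ## ?Z" by (subst assms(1)) simp
  also have "p @- c ## d ## ?Z = p @- c ## d ## q @- c ## d ## ?Z" by (subst Z) simp
  also have "\<dots> = u @- c ## d ## ?Z" by (subst assms(2)) simp
  finally have "u @- c ## d ## ?Z = (q @ [d, c]) @- (u @- c ## d ## ?Z)" by simp
  then show ?thesis using cycle_unique[of "q @ [d, c]" "u @- c ## d ## ?Z"] by simp
qed

lemma pad_less_take_right:
  assumes "pad (q @ w) <\<^sub>l\<^sub>e\<^sub>x pad v" "length v = length (q @ w)" "take (length q) v \<noteq> q"
  shows "pad q <\<^sub>l\<^sub>e\<^sub>x pad (take (length q) v)"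
  using assms
proof (induction q arbitrary: v)
  case (Cons c q)
  then show ?case by (cases v) auto
qed simp

text \<open>Maximality of u forbids v to start with q after xy = ab, and with p after xy = ba, since
  u ab q and u ba p are central. Hence comparing v with uab, which starts with q, is decided within
  the first |q| letters, and the result carries over to (qab)^omega; likewise for p.\<close>

lemma longest_central_gap:
  assumes ab: "b = a + 1" and u: "longest_central_prefix a b s u"
    and d: "central_decomp a b u p q"
    and s: "s = u @- [x, y] @- v @- s'" and v: "length v = length u + 2"
  shows "[x, y] = [a, b] \<and> pad (u @ [a, b]) <\<^sub>l\<^sub>e\<^sub>x pad v \<or> [x, y] = [b, a] \<and> pad v <\<^sub>l\<^sub>e\<^sub>x pad (u @ [b, a]) \<Longrightarrow>
      gap a b s u"
    and "x = a \<and> b < y \<or> x = b \<and> y < a \<Longrightarrow> gap a b s u"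
    and "[x, y] = [a, b] \<and> pad v <\<^sub>l\<^sub>e\<^sub>x pad (u @ [a, b]) \<or> pad [x, y] \<le>\<^sub>l\<^sub>e\<^sub>x pad [a, a] \<Longrightarrow> gap a b s q"
    and "[x, y] = [b, a] \<and> pad (u @ [b, a]) <\<^sub>l\<^sub>e\<^sub>x pad v \<or> pad [b, b] \<le>\<^sub>l\<^sub>e\<^sub>x pad [x, y] \<Longrightarrow> gap a b s p"
    and "[x, y] = [a, b] \<Longrightarrow> v \<noteq> u @ [a, b]" "[x, y] = [b, a] \<Longrightarrow> v \<noteq> u @ [b, a]"
proof -
  have uab: "u = p @ [a, b] @ q" and uba: "u = q @ [b, a] @ p"
    and cp: "central a b p" and cq: "central a b q"
    using d unfolding central_decomp_def by blast+
  have cu: "central a b u" using u by (simp add: longest_central_prefix_def)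
  have sets: "set u \<subseteq> {a, b}" "set p \<subseteq> {a, b}" "set q \<subseteq> {a, b}"
    using cu cp cq by (simp_all add: central_def)
  note pals = central_palindrome[OF cu] central_palindrome[OF cp] central_palindrome[OF cq]
  have q: "take (length q) v \<noteq> q" if "[x, y] = [a, b]"
  proof
    assume "take (length q) v = q"
    then have "s = (u @ [a, b] @ q) @- drop (length q) v @- s'"
      using s that by (metis append_take_drop_id shift_append)
    moreover have "central a b (u @ [a, b] @ q)"
    proof -
      \<comment> \<open>The reversal q ba u equals q ba p ab q, whose first part q ba p is u
        again.\<close>
      have "rev (u @ [a, b] @ q) = q @ [b, a] @ u" using pals by (simp add: palindrome_def)
      also have "\<dots> = q @ [b, a] @ p @ [a, b] @ q" using uab by blast
      also have "\<dots> = u @ [a, b] @ q" using uba by (metis append_assoc)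
      finally have "palindrome (u @ [a, b] @ q)" by (simp add: palindrome_def)
      then show ?thesis using pals sets by (intro centralI[of _ u q]) auto
    qed
    ultimately show False using longest_central_prefix_bound[OF u] by fastforce
  qed
  have p: "take (length p) v \<noteq> p" if "[x, y] = [b, a]"
  proof
    assume "take (length p) v = p"
    then have "s = (u @ [b, a] @ p) @- drop (length p) v @- s'"
      using s that by (metis append_take_drop_id shift_append)
    moreover have "central a b (u @ [b, a] @ p)"
    proof -
      have rev: "rev (u @ [b, a] @ p) = p @ [a, b] @ u" using pals by (simp add: palindrome_def)
      have "p @ [a, b] @ u = p @ [a, b] @ q @ [b, a] @ p" using uba by blast
      also have "\<dots> = u @ [b, a] @ p" using uab by (metis append_assoc)
      finally have eq: "p @ [a, b] @ u = u @ [b, a] @ p" .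
      then have "palindrome (u @ [b, a] @ p)" using rev by (simp add: palindrome_def)
      then show ?thesis using pals sets eq by (intro centralI[of _ p u]) auto
    qed
    ultimately show False using longest_central_prefix_bound[OF u] by fastforce
  qed
  show "[x, y] = [a, b] \<Longrightarrow> v \<noteq> u @ [a, b]" using q uba by (metis append_assoc append_eq_conv_conj)
  show "[x, y] = [b, a] \<Longrightarrow> v \<noteq> u @ [b, a]" using p uab by (metis append_assoc append_eq_conv_conj)
  have s: "s = u @- x ## y ## v @- s'" using s by simp
  have E: "cycle (u @ [a, b]) = u @- a ## b ## cycle (u @ [a, b])"
    "cycle (u @ [b, a]) = u @- b ## a ## cycle (u @ [b, a])"
    using cycle_decomp[of "u @ [a, b]"] cycle_decomp[of "u @ [b, a]"] by simp_all
  have gap_iff: "gap a b s u \<longleftrightarrow> a ## b ## cycle (u @ [a, b]) <\<^sub>l\<^sub>e\<^sub>x x ## y ## v @- s' \<and>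
      x ## y ## v @- s' <\<^sub>l\<^sub>e\<^sub>x b ## a ## cycle (u @ [b, a])"
    unfolding gap_def s using E by (metis word_less_shift)
  \<comment> \<open>A second letter outside {a, b} puts xy strictly between ab and ba, whatever
    follows.\<close>
  show "gap a b s u" if "x = a \<and> b < y \<or> x = b \<and> y < a"
    unfolding gap_iff using that ab by auto
  show "gap a b s u" if "[x, y] = [a, b] \<and> pad (u @ [a, b]) <\<^sub>l\<^sub>e\<^sub>x pad v \<or> [x, y] = [b, a] \<and> pad v <\<^sub>l\<^sub>e\<^sub>x pad (u @ [b, a])"
    using that
  proof
    assume *: "[x, y] = [a, b] \<and> pad (u @ [a, b]) <\<^sub>l\<^sub>e\<^sub>x pad v"
    have "(u @ [a, b]) @- cycle (u @ [a, b]) <\<^sub>l\<^sub>e\<^sub>x v @- s'"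
      using * v by (intro pad_less_imp_shift_less) auto
    then have "cycle (u @ [a, b]) <\<^sub>l\<^sub>e\<^sub>x v @- s'" by (subst E) simp
    then show ?thesis unfolding gap_iff using * ab by simp
  next
    assume *: "[x, y] = [b, a] \<and> pad v <\<^sub>l\<^sub>e\<^sub>x pad (u @ [b, a])"
    have "v @- s' <\<^sub>l\<^sub>e\<^sub>x (u @ [b, a]) @- cycle (u @ [b, a])"
      using * v by (intro pad_less_imp_shift_less) auto
    then have "v @- s' <\<^sub>l\<^sub>e\<^sub>x cycle (u @ [b, a])" by (subst E) simp
    then show ?thesis unfolding gap_iff using * ab by simp
  qed
  show "gap a b s q"
    if *: "[x, y] = [a, b] \<and> pad v <\<^sub>l\<^sub>e\<^sub>x pad (u @ [a, b]) \<or> pad [x, y] \<le>\<^sub>l\<^sub>e\<^sub>x pad [a, a]"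
  proof -
    let ?Z = "cycle (q @ [a, b])"
    \<comment> \<open>After the common prefix q the lower end continues with a, while u, and hence
      s, continues with b.\<close>
    have "?Z <\<^sub>l\<^sub>e\<^sub>x s" unfolding cycle_Christoffel_unfold(2) s using ab by (subst uba) simp
    moreover have "x ## y ## v @- s' <\<^sub>l\<^sub>e\<^sub>x a ## b ## ?Z"
      using *
    proof
      assume *: "[x, y] = [a, b] \<and> pad v <\<^sub>l\<^sub>e\<^sub>x pad (u @ [a, b])"
      have "pad (take (length q) v) <\<^sub>l\<^sub>e\<^sub>x pad q"
        using pad_less_take[of v q "[b, a] @ p @ [a, b]"] * q v uba by simp
      then have "take (length q) v @- drop (length q) v @- s' <\<^sub>l\<^sub>e\<^sub>x q @- a ## cycle (b # q @ [a])"
        using v uba by (intro pad_less_imp_shift_less) auto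
      then have "v @- s' <\<^sub>l\<^sub>e\<^sub>x ?Z"
        unfolding cycle_Christoffel_unfold(2) by (metis append_take_drop_id shift_append)
      then show ?thesis using * by simp
    next
      assume "pad [x, y] \<le>\<^sub>l\<^sub>e\<^sub>x pad [a, a]"
      then show ?thesis using ab by (auto simp: pad_def)
    qed
    ultimately show ?thesis
      unfolding gap_def s cycle_central_unfold[OF uba uab] by simp
  qed
  show "gap a b s p"
    if *: "[x, y] = [b, a] \<and> pad (u @ [b, a]) <\<^sub>l\<^sub>e\<^sub>x pad v \<or> pad [b, b] \<le>\<^sub>l\<^sub>e\<^sub>x pad [x, y]"
  proof -
    let ?Z = "cycle (p @ [b, a])"
    have "s <\<^sub>l\<^sub>e\<^sub>x ?Z" unfolding cycle_Christoffel_unfold(2) s using ab by (subst uab) simp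
    moreover have "b ## a ## ?Z <\<^sub>l\<^sub>e\<^sub>x x ## y ## v @- s'"
      using *
    proof
      assume *: "[x, y] = [b, a] \<and> pad (u @ [b, a]) <\<^sub>l\<^sub>e\<^sub>x pad v"
      have "pad p <\<^sub>l\<^sub>e\<^sub>x pad (take (length p) v)"
        using pad_less_take_right[of p "[a, b] @ q @ [b, a]" v] * p v uab by simp
      then have "p @- b ## cycle (a # p @ [b]) <\<^sub>l\<^sub>e\<^sub>x take (length p) v @- drop (length p) v @- s'"
        using v uab by (intro pad_less_imp_shift_less) auto
      then have "?Z <\<^sub>l\<^sub>e\<^sub>x v @- s'"
        unfolding cycle_Christoffel_unfold(2) by (metis append_take_drop_id shift_append)
      then show ?thesis using * by simp
    next
      assume "pad [b, b] \<le>\<^sub>l\<^sub>e\<^sub>x pad [x, y]"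
      then show ?thesis using ab by (auto simp: pad_def)
    qed
    ultimately show ?thesis
      unfolding gap_def s cycle_central_unfold[OF uab uba] by simp
  qed
qed

section \<open>Frequencies and the case distinction\<close>

lemma sum_list_binary:
  "set w \<subseteq> {a, a + 1} \<Longrightarrow> sum_list w = a * int (length w) + int (count_list w (a + 1))"
  by (induction w) (auto simp: algebra_simps)

theorem theorem4p8:
  fixes \<beta> t :: real and a b :: int and s :: "int stream" and I :: "real set"
  assumes "\<beta> > 1"
    and "0 \<le> t" and "t \<le> 1 - 1 / \<beta>"
    and "bar_expansion \<beta> t = a ## s" and "a \<in> digits \<beta>" and "s \<in> streams (digits \<beta>)"
    and "b = a + 1"
    and "I = {t..t + 1 / \<beta>}"
    and "sconst a <\<^sub>l\<^sub>e\<^sub>x s" and "s <\<^sub>l\<^sub>e\<^sub>x sconst b"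
    and "\<not> (\<exists>\<alpha>\<in>{real_of_int a..real_of_int b}. a ## s = lower_mech \<alpha> \<or> b ## s = upper_mech \<alpha>)"
  shows
    "(\<exists>!u. longest_central_prefix a b s u) \<and>
     (\<exists>!S. is_orbit_closure \<beta> S \<and> invariant \<beta> S \<and> S \<subseteq> I) \<and>
     (\<forall>u. longest_central_prefix a b s u \<longrightarrow>
       \<comment> \<open>(a)\<close>
       (\<forall>k v s'. k \<ge> 1 \<and> u = replicate k a \<and> s = replicate k a @- v @- s' \<and>
          length v = k + 1 \<and> v \<in> lists (digits \<beta>) \<and> s' \<in> streams (digits \<beta>) \<longrightarrow>
          (pad v <\<^sub>l\<^sub>e\<^sub>x pad (replicate (k + 1) a) \<longrightarrow> s \<le>\<^sub>l\<^sub>e\<^sub>x sconst a) \<and>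
          (pad (replicate (k + 1) a) <\<^sub>l\<^sub>e\<^sub>x pad v \<and> pad v <\<^sub>l\<^sub>e\<^sub>x pad (b # replicate k a) \<longrightarrow>
             contains_orbit_closure_of \<beta> I (b # replicate (k + 1) a) (a + 1 / (k + 2))) \<and>
          (pad (b # replicate k a) <\<^sub>l\<^sub>e\<^sub>x pad v \<longrightarrow>
             contains_orbit_closure_of \<beta> I (b # replicate k a) (a + 1 / (k + 1))) \<and>
          v \<noteq> replicate (k + 1) a \<and> v \<noteq> b # replicate k a) \<and>
       \<comment> \<open>(b)\<close>
       (\<forall>k v s'. k \<ge> 1 \<and> u = replicate k b \<and> s = replicate k b @- v @- s' \<and>
          length v = k + 1 \<and> v \<in> lists (digits \<beta>) \<and> s' \<in> streams (digits \<beta>) \<longrightarrow>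
          (pad (replicate (k + 1) b) <\<^sub>l\<^sub>e\<^sub>x pad v \<longrightarrow> sconst b \<le>\<^sub>l\<^sub>e\<^sub>x s) \<and>
          (pad (a # replicate k b) <\<^sub>l\<^sub>e\<^sub>x pad v \<and> pad v <\<^sub>l\<^sub>e\<^sub>x pad (replicate (k + 1) b) \<longrightarrow>
             contains_orbit_closure_of \<beta> I (replicate (k + 1) b @ [a]) (b - 1 / (k + 2))) \<and>
          (pad v <\<^sub>l\<^sub>e\<^sub>x pad (a # replicate k b) \<longrightarrow>
             contains_orbit_closure_of \<beta> I (replicate k b @ [a]) (b - 1 / (k + 1))) \<and>
          v \<noteq> replicate (k + 1) b \<and> v \<noteq> a # replicate k b) \<and>
       \<comment> \<open>(c)\<close>
       (\<not> letter_power u \<longrightarrow>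
          (\<exists>!pq. central_decomp a b u (fst pq) (snd pq)) \<and>
          (\<forall>p q x y v s'. central_decomp a b u p q \<and> s = u @- [x, y] @- v @- s' \<and>
             x \<in> digits \<beta> \<and> y \<in> digits \<beta> \<and>
             length v = length u + 2 \<and> v \<in> lists (digits \<beta>) \<and> s' \<in> streams (digits \<beta>) \<longrightarrow>
             ([x, y] = [a, b] \<and> pad (u @ [a, b]) <\<^sub>l\<^sub>e\<^sub>x pad v \<or>
              [x, y] = [b, a] \<and> pad v <\<^sub>l\<^sub>e\<^sub>x pad (u @ [b, a]) \<longrightarrow>
                contains_orbit_closure_of \<beta> I (b # u @ [a])
                  (a + (count_list u b + 1) / (length u + 2))) \<and>
             ([x, y] = [a, b] \<and> pad v <\<^sub>l\<^sub>e\<^sub>x pad (u @ [a, b]) \<or>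
              pad [x, y] \<le>\<^sub>l\<^sub>e\<^sub>x pad [a, a] \<longrightarrow>
                contains_orbit_closure_of \<beta> I (b # q @ [a])
                  (a + (count_list q b + 1) / (length q + 2))) \<and>
             ([x, y] = [b, a] \<and> pad (u @ [b, a]) <\<^sub>l\<^sub>e\<^sub>x pad v \<or>
              pad [b, b] \<le>\<^sub>l\<^sub>e\<^sub>x pad [x, y] \<longrightarrow>
                contains_orbit_closure_of \<beta> I (b # p @ [a])
                  (a + (count_list p b + 1) / (length p + 2))) \<and>
             ([x, y] = [a, b] \<longrightarrow> v \<noteq> u @ [a, b]) \<and>
             ([x, y] = [b, a] \<longrightarrow> v \<noteq> u @ [b, a]))))"
proof -
  note \<beta> = \<open>\<beta> > 1\<close> and exp = \<open>bar_expansion \<beta> t = a ## s\<close> and ab = \<open>b = a + 1\<close>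
  have a: "0 \<le> a" using \<open>a \<in> digits \<beta>\<close> by (simp add: digits_def)
  \<comment> \<open>The first digit at 0 would be -1, so a nonnegative first digit forces t >
    0.\<close>
  have "\<lceil>\<beta> * t\<rceil> - 1 = a" using exp bar_expansion_Cons[of \<beta> t] by simp
  then have "0 < \<beta> * t" using a by linarith
  then have t: "0 < t" using \<beta> by (simp add: zero_less_mult_iff)
  note main = gap_orbit_closure[OF \<beta> t \<open>t \<le> 1 - 1 / \<beta>\<close> exp a ab \<open>I = _\<close>]
  have closure: "contains_orbit_closure_of \<beta> I (b # z @ [a]) \<alpha>"
    if "gap a b s z" "central a b z" "\<alpha> = a + (count_list z b + 1) / (length z + 2)" for z \<alpha>
  proof -
    have "set z \<subseteq> {a, a + 1}" using that ab by (simp add: central_def)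
    then have "real_of_int (sum_list (a # z @ [b])) / real (length z + 2) = \<alpha>"
      using sum_list_binary[of z a] ab that(3) by (simp add: field_simps)
    then show ?thesis using main(1)[of z] that by (simp add: gap_def)
  qed
  have count: "count_list (replicate k c) d = (if c = d then k else 0)" for k :: nat and c d :: int
    by (induction k) auto
  \<comment> \<open>The first letter of s is itself a central prefix, so the longest one is not
    empty.\<close>
  have shd_s: "shd s = a \<or> shd s = b"
  proof -
    have "sconst c = c ## sconst c" for c :: int by (metis id_apply siterate.code)
    then have "a \<le> shd s" "shd s \<le> b"
      using \<open>sconst a <\<^sub>l\<^sub>e\<^sub>x s\<close> \<open>s <\<^sub>l\<^sub>e\<^sub>x sconst b\<close>
      by (metis stream.collapse word_less_Cons order_le_less)+
    then show ?thesis using ab by linarith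
  qed
  have ex1u: "\<exists>!u. longest_central_prefix a b s u"
    by (rule longest_central_prefix_exists[OF ab]) (rule assms)
  then obtain u where u: "longest_central_prefix a b s u" by blast
  have "\<exists>z. central a b z \<and> gap a b s z"
  proof (cases "letter_power u")
    case True
    then obtain c k where uk: "u = replicate k c" by (auto simp: letter_power_def)
    have cu: "central a b u" "stake k s = u" using u uk by (auto simp: longest_central_prefix_def)
    have "central a b [shd s]" using central_replicate[of "shd s" a b 1] shd_s by simp
    then have k: "k \<ge> 1"
      using longest_central_prefix_bound[OF u, of "[shd s]" "stl s"] uk by simp
    then have c: "c = a \<or> c = b" using cu uk by (auto simp: central_def)
    define v s' where "v = stake (k + 1) (sdrop k s)" and "s' = sdrop (k + 1) (sdrop k s)"
    have v: "length v = k + 1" by (simp add: v_def)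
    have s: "s = replicate k c @- v @- s'"
      unfolding v_def s'_def stake_sdrop uk[symmetric] cu(2)[symmetric] ..
    show ?thesis
      using c
    proof
      assume c: "c = a"
      note G = longest_lower_power_gap[OF ab u[unfolded uk c] k s[unfolded c] v]
      \<comment> \<open>In this case s would lie below a^omega, against the assumption; the strict
        comparisons that remain lead to the two gaps.\<close>
      have "\<not> pad v <\<^sub>l\<^sub>e\<^sub>x pad (replicate (k + 1) a)"
        using G(1) \<open>sconst a <\<^sub>l\<^sub>e\<^sub>x s\<close> word_less_asym by blast
      then have "gap a b s (replicate k a) \<or> gap a b s (replicate (k - 1) a)"
        using G pad_less_linear[of v "replicate (k + 1) a"] pad_less_linear[of v "b # replicate k a"] v
        by auto
      then show ?thesis using central_replicate[of a a b] by blast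
    next
      assume c: "c = b"
      note G = longest_upper_power_gap[OF ab u[unfolded uk c] k s[unfolded c] v]
      have "\<not> pad (replicate (k + 1) b) <\<^sub>l\<^sub>e\<^sub>x pad v"
        using G(1) \<open>s <\<^sub>l\<^sub>e\<^sub>x sconst b\<close> word_less_asym by blast
      then have "gap a b s (replicate k b) \<or> gap a b s (replicate (k - 1) b)"
        using G pad_less_linear[of v "replicate (k + 1) b"] pad_less_linear[of v "a # replicate k b"] v
        by auto
      then show ?thesis using central_replicate[of b a b] by blast
    qed
  next
    case False
    have cu: "central a b u" "stake (length u) s = u" using u by (auto simp: longest_central_prefix_def)
    obtain p q where d: "central_decomp a b u p q" using central_decomp_exists[OF cu(1) False ab] by blast
    define r where "r = sdrop (length u) s"
    define x y where "x = shd r" and "y = shd (stl r)"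
    define v s' where "v = stake (length u + 2) (stl (stl r))" and "s' = sdrop (length u + 2) (stl (stl r))"
    have v: "length v = length u + 2" by (simp add: v_def)
    have "r = [x, y] @- v @- s'" unfolding v_def s'_def stake_sdrop by (simp add: x_def y_def)
    then have s: "s = u @- [x, y] @- v @- s'" using stake_sdrop[of "length u" s] cu(2) by (simp add: r_def)
    note G = longest_central_gap[OF ab u d s v]
    have lin: "pad v <\<^sub>l\<^sub>e\<^sub>x pad (u @ w) \<or> v = u @ w \<or> pad (u @ w) <\<^sub>l\<^sub>e\<^sub>x pad v" if "length w = 2" for w
      using pad_less_linear[of v "u @ w"] v that by simp
    \<comment> \<open>The first alternative, with y outside {a, b}, belongs to none of the three
      cases of (c) but is needed for the unique orbit closure.\<close>
    consider "x = a \<and> b < y \<or> x = b \<and> y < a" | "[x, y] = [a, b]" | "[x, y] = [b, a]"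
      | "x < a \<or> x = a \<and> y \<le> a" | "b < x \<or> x = b \<and> b \<le> y" using ab by force
    then have "gap a b s u \<or> gap a b s p \<or> gap a b s q"
    proof cases
      case 1
      then show ?thesis using G(2) by blast
    next
      case 2
      then show ?thesis using G(1,3,5) lin[of "[a, b]"] by force
    next
      case 3
      then show ?thesis using G(1,4,6) lin[of "[b, a]"] by force
    next
      case 4
      then have "pad [x, y] \<le>\<^sub>l\<^sub>e\<^sub>x pad [a, a]" by (auto simp: pad_def word_le_def)
      then show ?thesis using G(3) by blast
    next
      case 5
      then have "pad [b, b] \<le>\<^sub>l\<^sub>e\<^sub>x pad [x, y]" by (auto simp: pad_def word_le_def)
      then show ?thesis using G(4) by blast
    qed
    then show ?thesis using cu d by (auto simp: central_decomp_def)
  qed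
  then obtain z where "central a b z" "gap a b s z" by blast
  then have ex1S: "\<exists>!S. is_orbit_closure \<beta> S \<and> invariant \<beta> S \<and> S \<subseteq> I"
    by (intro main(2)[of z]) (simp_all add: gap_def)
  have ba: "b \<noteq> a" using ab by simp
  show ?thesis
  \<comment> \<open>Goals 3 to 7 are part (a), 8 to 12 part (b) and 13 to 18 part (c), each ending
    with the excluded equalities.\<close>
  proof (intro conjI allI impI, goal_cases)
    case 1
    show ?case by (rule ex1u)
  next
    case 2
    show ?case by (rule ex1S)
  next
    case (3 u k v s')
    then have "s <\<^sub>l\<^sub>e\<^sub>x sconst a" by (intro longest_lower_power_gap(1)[OF ab, of s k v s']) auto
    then show ?case by (simp add: word_le_def)
  next
    case (4 u k v s')
    then have g: "gap a b s (replicate k a)" by (intro longest_lower_power_gap(2)[OF ab, of s k v s']) auto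
    have e: "b # replicate (k + 1) a = b # replicate k a @ [a]" by (simp add: replicate_append_same)
    show ?case unfolding e using ba
      by (intro closure g central_replicate) (auto simp: count add.commute)
  next
    case (5 u k v s')
    then have g: "gap a b s (replicate (k - 1) a)" by (intro longest_lower_power_gap(3)[OF ab, of s k v s']) auto
    from 5 obtain m where m: "k = Suc m" by (cases k) auto
    have e: "b # replicate k a = b # replicate (k - 1) a @ [a]" by (simp add: m replicate_append_same)
    show ?case unfolding e using ba
      by (intro closure g central_replicate) (auto simp: count m add.commute)
  next
    case (6 u k v s')
    then show ?case by (intro longest_lower_power_gap(4)[OF ab, of s k v s']) auto
  next
    case (7 u k v s')
    then show ?case by (intro longest_lower_power_gap(5)[OF ab, of s k v s']) auto
  next
    case (8 u k v s')
    then have "sconst b <\<^sub>l\<^sub>e\<^sub>x s" by (intro longest_upper_power_gap(1)[OF ab, of s k v s']) auto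
    then show ?case by (simp add: word_le_def)
  next
    case (9 u k v s')
    then have g: "gap a b s (replicate k b)" by (intro longest_upper_power_gap(2)[OF ab, of s k v s']) auto
    \<comment> \<open>With z = b^k the general frequency is a + (k + 1) / (k + 2) = b - 1 / (k +
      2).\<close>
    have e: "replicate (k + 1) b @ [a] = b # replicate k b @ [a]" by simp
    show ?case unfolding e
      by (intro closure g central_replicate) (auto simp: count ab field_simps)
  next
    case (10 u k v s')
    then have g: "gap a b s (replicate (k - 1) b)" by (intro longest_upper_power_gap(3)[OF ab, of s k v s']) auto
    from 10 obtain m where m: "k = Suc m" by (cases k) auto
    have e: "replicate k b @ [a] = b # replicate (k - 1) b @ [a]" by (simp add: m)
    show ?case unfolding e
      by (intro closure g central_replicate) (auto simp: count ab m field_simps)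
  next
    case (11 u k v s')
    then show ?case by (intro longest_upper_power_gap(4)[OF ab, of s k v s']) auto
  next
    case (12 u k v s')
    then show ?case by (intro longest_upper_power_gap(5)[OF ab, of s k v s']) auto
  next
    case (13 u)
    then have "central a b u" by (simp add: longest_central_prefix_def)
    then obtain p q where "central_decomp a b u p q"
      using central_decomp_exists 13(2) ab by blast
    then show ?case
      using central_decomp_unique[OF _ _ ab] by (intro ex1I[of _ "(p, q)"]) (auto simp: prod_eq_iff)
  next
    case (14 u p q x y v s')
    then have "gap a b s u" by (intro longest_central_gap(1)[OF ab, of s u p q x y v s']) blast+
    then show ?case using 14(1) by (intro closure) (auto simp: longest_central_prefix_def)
  next
    case (15 u p q x y v s')
    then have "gap a b s q" by (intro longest_central_gap(3)[OF ab, of s u p q x y v s']) blast+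
    then show ?case using 15(3) by (intro closure) (auto simp: central_decomp_def)
  next
    case (16 u p q x y v s')
    then have "gap a b s p" by (intro longest_central_gap(4)[OF ab, of s u p q x y v s']) blast+
    then show ?case using 16(3) by (intro closure) (auto simp: central_decomp_def)
  next
    case (17 u p q x y v s')
    then show ?case by (intro longest_central_gap(5)[OF ab, of s u p q x y v s']) blast+
  next
    case (18 u p q x y v s')
    then show ?case by (intro longest_central_gap(6)[OF ab, of s u p q x y v s']) blast+
  qed
qed

end
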